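(* Let $Q,R,S\in\mathfrak{P}$ with $Q\cap R=\emptyset$ and $Q\cap S=\emptyset$; let $X$ be the carrier of $R$ and $Y$ the carrier of $Q$. Then: (i) $R\oplus Q\sqsubseteq_G S\oplus Q$ implies $R\sqsubseteq_G S$. (ii) Let $\epsilon:\mathcal{E}(R\oplus Q)\to\mathcal{E}(S\oplus Q)$ be an injective homomorphism (with respect to $\le_+$) such that for every $P\in\mathfrak{P}_r$, $\xi\in\mathcal{H}(P,R\oplus Q)$, $x\in P$ we have $\alpha_{P,\eta(\xi)}(x)=\epsilon(\alpha_{P,\xi}(x))$, where $\eta(\xi)(z):=\epsilon(\alpha_{P,\xi}(z))_1$ for $z\in P$. Let $\mathcal{E}(Q)_*:=\{(y,D\cup X,U):(y,D,U)\in\mathcal{E}(Q)\}$. If $Y\subseteq\{\epsilon(\mathfrak a)_1:\mathfrak a\in\mathcal{E}(Q)_*\}$, then $R\sqsubseteq_I S$.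
   Context: $\mathfrak{P}$ is the class of finite nonempty posets and $\mathfrak{P}_r$ a fixed system of representatives of its isomorphism classes. $\mathcal{H}(P,Q)$ is the set of order-preserving maps $P\to Q$. $A\oplus B$ is the ordinal sum of disjoint posets (every element of $A$ below every element of $B$). For $A\subseteq P$, $x\in A$: $\gamma_A(x)$ is the set of $y\in A$ joined to $x$ by a sequence $x=z_0,\dots,z_L=y$ in $A$ ($L\ge0$) with consecutive elements strictly comparable; for a map $\xi$ on $P$, $G_\xi(x):=\gamma_{\xi^{-1}(\xi(x))}(x)$. For $A\subseteq P$, ${\downarrow^{\circ}}A:=\{y: y\le a\text{ for some }a\in A\}\setminus A$, ${\uparrow_{\circ}}A:=\{y: y\ge a\text{ for some }a\in A\}\setminus A$. The EV-system $\mathcal{E}(P)$ is the set of triples $(x,D,U)$ with $x\in P$, $D\subseteq{\downarrow^{\circ}}\{x\}$, $U\subseteq{\uparrow_{\circ}}\{x\}$; $\mathfrak a<_+\mathfrak b$ iff $\mathfrak a_1\in\mathfrak b_2$ and $\mathfrak b_1\in\mathfrak a_3$; $\le_+$ is $<_+$ plus equality; a homomorphism $f$ between EV-systems satisfies $\mathfrak a\le_+\mathfrak b\Rightarrow f(\mathfrak a)\le_+ f(\mathfrak b)$. For $\xi\in\mathcal{H}(P,Q)$, $\alpha_{P,\xi}(x):=(\xi(x),\xi({\downarrow^{\circ}}G_\xi(x)),\xi({\uparrow_{\circ}}G_\xi(x)))$. A Hom-scheme from $R$ to $S$ is a family $(\rho_P)_{P\in\mathfrak{P}_r}$ of maps $\rho_P:\mathcal{H}(P,R)\to\mathcal{H}(P,S)$;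 strong if each $\rho_P$ is injective; a G-scheme if $G_{\rho_P(\xi)}(x)=G_\xi(x)$ for all $P,\xi,x$; an I-scheme if for all $P,P'\in\mathfrak{P}_r$, $\xi\in\mathcal{H}(P,R)$, $\zeta\in\mathcal{H}(P',R)$, $x\in P$, $y\in P'$: $\alpha_{P,\xi}(x)\le_+\alpha_{P',\zeta}(y)$ implies $\alpha_{P,\rho_P(\xi)}(x)\le_+\alpha_{P',\rho_{P'}(\zeta)}(y)$, with $<_+$ preserved. $R\sqsubseteq_G S$ / $R\sqsubseteq_I S$ mean that a strong G-scheme / strong I-scheme from $R$ to $S$ exists. *)

theory Defs
  imports Main "HOL-Library.FuncSet"
begin

text \<open>
  A poset is given by its reflexive order relation; its carrier is the \<^const>\<open>Field\<close> of that
  relation, so the pair (carrier, order) is determined by the relation alone.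
\<close>

definition fin_poset :: "'a rel \<Rightarrow> bool" where
  "fin_poset P \<longleftrightarrow> Partial_order P \<and> finite (Field P) \<and> Field P \<noteq> {}"

definition strict_comparable :: "'a rel \<Rightarrow> 'a \<Rightarrow> 'a \<Rightarrow> bool" where
  "strict_comparable P x y \<longleftrightarrow> x \<noteq> y \<and> ((x, y) \<in> P \<or> (y, x) \<in> P)"

definition poset_iso :: "'a rel \<Rightarrow> 'b rel \<Rightarrow> bool" where
  "poset_iso P P' \<longleftrightarrow> (\<exists>f. bij_betw f (Field P) (Field P') \<and>
     (\<forall>x\<in>Field P. \<forall>y\<in>Field P. (x, y) \<in> P \<longleftrightarrow> (f x, f y) \<in> P'))"

text \<open>
  Every finite poset has an isomorphic copy on natural numbers, so the last clause says that
  every isomorphism class of finite nonempty posets is represented.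
\<close>

definition representatives :: "'p rel set \<Rightarrow> bool" where
  "representatives Pr \<longleftrightarrow>
     (\<forall>P\<in>Pr. fin_poset P) \<and>
     (\<forall>P\<in>Pr. \<forall>P'\<in>Pr. poset_iso P P' \<longrightarrow> P = P') \<and>
     (\<forall>N :: nat rel. fin_poset N \<longrightarrow> (\<exists>P\<in>Pr. poset_iso N P))"

definition ord_sum :: "'a rel \<Rightarrow> 'a rel \<Rightarrow> 'a rel" (infixr \<open>\<oplus>\<close> 65) where
  "A \<oplus> B = A \<union> B \<union> Field A \<times> Field B"

text \<open>
  Maps are extensional, so that equality of functions is equality of maps on the carrier.
\<close>

definition hom :: "'p rel \<Rightarrow> 'a rel \<Rightarrow> ('p \<Rightarrow> 'a) set" where
  "hom P Q = {\<xi> \<in> Field P \<rightarrow>\<^sub>E Field Q.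
     monotone_on (Field P) (\<lambda>x y. (x, y) \<in> P) (\<lambda>a b. (a, b) \<in> Q) \<xi>}"

definition conn_comp :: "'p rel \<Rightarrow> 'p set \<Rightarrow> 'p \<Rightarrow> 'p set" where
  "conn_comp P A x = {y. \<exists>(L :: nat) z. z 0 = x \<and> z L = y \<and>
     (\<forall>i\<le>L. z i \<in> A) \<and> (\<forall>i<L. strict_comparable P (z i) (z (Suc i)))}"

definition G_comp :: "'p rel \<Rightarrow> ('p \<Rightarrow> 'a) \<Rightarrow> 'p \<Rightarrow> 'p set" where
  "G_comp P \<xi> x = conn_comp P {y \<in> Field P. \<xi> y = \<xi> x} x"

definition down_open :: "'p rel \<Rightarrow> 'p set \<Rightarrow> 'p set" where
  "down_open P A = {y. \<exists>a\<in>A. (y, a) \<in> P} - A"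

definition up_open :: "'p rel \<Rightarrow> 'p set \<Rightarrow> 'p set" where
  "up_open P A = {y. \<exists>a\<in>A. (a, y) \<in> P} - A"

type_synonym 'a ev = "'a \<times> 'a set \<times> 'a set"

definition EV :: "'a rel \<Rightarrow> 'a ev set" where
  "EV P = {(x, D, U). x \<in> Field P \<and> D \<subseteq> down_open P {x} \<and> U \<subseteq> up_open P {x}}"

definition ev_less :: "'a ev \<Rightarrow> 'a ev \<Rightarrow> bool" (infix \<open><\<^sub>+\<close> 50) where
  "\<aa> <\<^sub>+ \<bb> \<longleftrightarrow> fst \<aa> \<in> fst (snd \<bb>) \<and> fst \<bb> \<in> snd (snd \<aa>)"

definition ev_le :: "'a ev \<Rightarrow> 'a ev \<Rightarrow> bool" (infix \<open>\<le>\<^sub>+\<close> 50) where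
  "\<aa> \<le>\<^sub>+ \<bb> \<longleftrightarrow> \<aa> <\<^sub>+ \<bb> \<or> \<aa> = \<bb>"

definition ev_hom :: "'a rel \<Rightarrow> 'b rel \<Rightarrow> ('a ev \<Rightarrow> 'b ev) \<Rightarrow> bool" where
  "ev_hom P Q f \<longleftrightarrow> f \<in> EV P \<rightarrow> EV Q \<and> monotone_on (EV P) (\<le>\<^sub>+) (\<le>\<^sub>+) f"

definition ev_of :: "'p rel \<Rightarrow> ('p \<Rightarrow> 'a) \<Rightarrow> 'p \<Rightarrow> 'a ev" (\<open>\<alpha>\<close>) where
  "\<alpha> P \<xi> x = (\<xi> x, \<xi> ` down_open P (G_comp P \<xi> x), \<xi> ` up_open P (G_comp P \<xi> x))"

type_synonym ('p, 'a, 'b) scheme = "'p rel \<Rightarrow> ('p \<Rightarrow> 'a) \<Rightarrow> ('p \<Rightarrow> 'b)"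

definition hom_scheme :: "'p rel set \<Rightarrow> 'a rel \<Rightarrow> 'b rel \<Rightarrow> ('p, 'a, 'b) scheme \<Rightarrow> bool" where
  "hom_scheme Pr R S \<rho> \<longleftrightarrow> (\<forall>P\<in>Pr. \<rho> P \<in> hom P R \<rightarrow> hom P S)"

definition strong_scheme :: "'p rel set \<Rightarrow> 'a rel \<Rightarrow> ('p, 'a, 'b) scheme \<Rightarrow> bool" where
  "strong_scheme Pr R \<rho> \<longleftrightarrow> (\<forall>P\<in>Pr. inj_on (\<rho> P) (hom P R))"

definition G_scheme :: "'p rel set \<Rightarrow> 'a rel \<Rightarrow> 'b rel \<Rightarrow> ('p, 'a, 'b) scheme \<Rightarrow> bool" where
  "G_scheme Pr R S \<rho> \<longleftrightarrow> hom_scheme Pr R S \<rho> \<and>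
     (\<forall>P\<in>Pr. \<forall>\<xi>\<in>hom P R. \<forall>x\<in>Field P. G_comp P (\<rho> P \<xi>) x = G_comp P \<xi> x)"

definition I_scheme :: "'p rel set \<Rightarrow> 'a rel \<Rightarrow> 'b rel \<Rightarrow> ('p, 'a, 'b) scheme \<Rightarrow> bool" where
  "I_scheme Pr R S \<rho> \<longleftrightarrow> hom_scheme Pr R S \<rho> \<and>
     (\<forall>P\<in>Pr. \<forall>P'\<in>Pr. \<forall>\<xi>\<in>hom P R. \<forall>\<zeta>\<in>hom P' R. \<forall>x\<in>Field P. \<forall>y\<in>Field P'.
        (\<alpha> P \<xi> x \<le>\<^sub>+ \<alpha> P' \<zeta> y \<longrightarrow> \<alpha> P (\<rho> P \<xi>) x \<le>\<^sub>+ \<alpha> P' (\<rho> P' \<zeta>) y) \<and>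
        (\<alpha> P \<xi> x <\<^sub>+ \<alpha> P' \<zeta> y \<longrightarrow> \<alpha> P (\<rho> P \<xi>) x <\<^sub>+ \<alpha> P' (\<rho> P' \<zeta>) y))"

definition G_below :: "'p rel set \<Rightarrow> 'a rel \<Rightarrow> 'b rel \<Rightarrow> bool" where
  "G_below Pr R S \<longleftrightarrow> (\<exists>\<rho>. G_scheme Pr R S \<rho> \<and> strong_scheme Pr R \<rho>)"

definition I_below :: "'p rel set \<Rightarrow> 'a rel \<Rightarrow> 'b rel \<Rightarrow> bool" where
  "I_below Pr R S \<longleftrightarrow> (\<exists>\<rho>. I_scheme Pr R S \<rho> \<and> strong_scheme Pr R \<rho>)"

definition ev_induced :: "('a ev \<Rightarrow> 'b ev) \<Rightarrow> 'p rel \<Rightarrow> ('p \<Rightarrow> 'a) \<Rightarrow> ('p \<Rightarrow> 'b)" (\<open>\<eta>\<close>) where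
  "\<eta> \<epsilon> P \<xi> = (\<lambda>z\<in>Field P. fst (\<epsilon> (\<alpha> P \<xi> z)))"

definition EV_star :: "'a set \<Rightarrow> 'a rel \<Rightarrow> 'a ev set" where
  "EV_star X Q = {(y, D \<union> X, U) | y D U. (y, D, U) \<in> EV Q}"

end

theory Submission imports Defs begin

text \<open>
  (i) The components of a map \<open>\<xi>\<close> are determined by its ties, the pairs \<open>x \<le> y\<close> with
  \<open>\<xi> x = \<xi> y\<close>. Hence \<open>R \<sqsubseteq>\<^sub>G S\<close> holds iff, for every finite poset \<open>P\<close> and every set
  \<open>T\<close> of ties, the number \<open>a\<close> of maps from \<open>P\<close> to \<open>R\<close> with tie set \<open>T\<close> is at most the
  corresponding number \<open>b\<close> for \<open>S\<close>. Put \<open>n\<close> disjoint copies of \<open>P\<close> below a copy of \<open>Q\<close>, where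
  ties are prescribed by \<open>T\<close> on every copy of \<open>P\<close>, and there are none elsewhere. There are at
  least \<open>a ^ n\<close> such maps to \<open>R \<oplus> Q\<close>. A map of this kind to \<open>S \<oplus> Q\<close> sends all copies of \<open>P\<close> to
  \<open>S\<close>, because \<open>Q\<close> has no strict map to itself lying strictly above one of its points; so there
  are at most \<open>b ^ n * C\<close> of them, with \<open>C\<close> independent of \<open>n\<close>. Hence \<open>a ^ n \<le> b ^ n * C\<close> for
  all \<open>n\<close>, and \<open>a \<le> b\<close>.

  (ii) Extend \<open>\<xi> : P \<rightarrow> R\<close> by the identity to the poset \<open>(P + R) \<oplus> Q\<close>, apply \<open>\<eta>\<close>, and restrict
  the result to \<open>P\<close>. On \<open>P\<close> the extension only adds \<open>Field Q\<close> to the third components of the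
  EV-triples, so all of them lie strictly below \<open>EV_star (Field R) Q\<close>; as the image of the
  latter covers \<open>Q\<close>, the restricted map has values in \<open>S\<close>. Its triples, with the fixed set \<open>Z\<close>
  of values of \<open>\<eta>\<close> on \<open>Q\<close> added to the third components, are the \<open>\<epsilon>\<close>-images of the extended
  triples. The values in \<open>S\<close> are strictly below \<open>Z\<close>, so \<open>Z\<close> can be removed again.
\<close>

section \<open>Order-preserving maps, finite posets and ordinal sums\<close>

lemma hom_iff:
  "\<xi> \<in> hom P A \<longleftrightarrow> \<xi> \<in> extensional (Field P) \<and> (\<forall>x\<in>Field P. \<xi> x \<in> Field A) \<and>
     (\<forall>x y. (x, y) \<in> P \<longrightarrow> (\<xi> x, \<xi> y) \<in> A)"
  unfolding hom_def PiE_def monotone_on_def by (auto intro: FieldI1 FieldI2)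

lemma finite_hom: "finite (Field P) \<Longrightarrow> finite (Field A) \<Longrightarrow> finite (hom P A)"
  unfolding hom_def by (rule finite_subset[OF _ finite_PiE]) auto

lemma partial_orderD:
  assumes "Partial_order P"
  shows "x \<in> Field P \<Longrightarrow> (x, x) \<in> P"
    "(x, y) \<in> P \<Longrightarrow> (y, z) \<in> P \<Longrightarrow> (x, z) \<in> P"
    "(x, y) \<in> P \<Longrightarrow> (y, x) \<in> P \<Longrightarrow> x = y"
  using assms unfolding partial_order_on_def preorder_on_def
  by (meson refl_onD, meson transD, meson antisymD)

lemma fin_posetD:
  assumes "fin_poset P"
  shows "finite (Field P)" "x \<in> Field P \<Longrightarrow> (x, x) \<in> P"
    "(x, y) \<in> P \<Longrightarrow> (y, z) \<in> P \<Longrightarrow> (x, z) \<in> P"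
    "(x, y) \<in> P \<Longrightarrow> (y, x) \<in> P \<Longrightarrow> x = y"
  using assms partial_orderD[of P] unfolding fin_poset_def by blast+

lemma fin_posetI:
  assumes "finite (Field P)" "Field P \<noteq> {}" "\<And>x. x \<in> Field P \<Longrightarrow> (x, x) \<in> P"
    "\<And>x y z. (x, y) \<in> P \<Longrightarrow> (y, z) \<in> P \<Longrightarrow> (x, z) \<in> P"
    "\<And>x y. (x, y) \<in> P \<Longrightarrow> (y, x) \<in> P \<Longrightarrow> x = y"
  shows "fin_poset P"
  unfolding fin_poset_def partial_order_on_def preorder_on_def refl_on_def trans_def antisym_def
  using assms by (auto intro: FieldI1 FieldI2)

lemma Field_ord_sum: "Field (A \<oplus> B) = Field A \<union> Field B"
  unfolding ord_sum_def Field_def by auto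

lemma ord_sum_iff:
  "(x, y) \<in> A \<oplus> B \<longleftrightarrow> (x, y) \<in> A \<or> (x, y) \<in> B \<or> x \<in> Field A \<and> y \<in> Field B"
  unfolding ord_sum_def by auto

lemma fin_poset_ord_sum:
  assumes A: "fin_poset A" and B: "fin_poset B" and "Field B \<inter> Field A = {}"
  shows "fin_poset (A \<oplus> B)"
proof (rule fin_posetI)
  have disj: "x \<in> Field A \<Longrightarrow> x \<in> Field B \<Longrightarrow> False" for x using assms(3) by auto
  show "finite (Field (A \<oplus> B))" "Field (A \<oplus> B) \<noteq> {}"
    using A B by (auto simp: Field_ord_sum fin_poset_def)
  show "(x, x) \<in> A \<oplus> B" if "x \<in> Field (A \<oplus> B)" for x
    using that fin_posetD(2)[OF A] fin_posetD(2)[OF B] by (auto simp: Field_ord_sum ord_sum_iff)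
  show "(x, z) \<in> A \<oplus> B" if "(x, y) \<in> A \<oplus> B" "(y, z) \<in> A \<oplus> B" for x y z
    using that fin_posetD(3)[OF A] fin_posetD(3)[OF B]
    unfolding ord_sum_iff by (meson disj FieldI1 FieldI2)
  show "x = y" if "(x, y) \<in> A \<oplus> B" "(y, x) \<in> A \<oplus> B" for x y
    using that fin_posetD(4)[OF A] fin_posetD(4)[OF B]
    unfolding ord_sum_iff by (meson disj FieldI1 FieldI2)
qed

section \<open>Ties and fibre components\<close>

definition tie :: "'p rel \<Rightarrow> ('p \<Rightarrow> 'a) \<Rightarrow> 'p rel" where
  "tie P \<xi> = {(x, y) \<in> P. \<xi> x = \<xi> y}"

lemma conn_comp_eq_rtrancl:
  "conn_comp P A x =
     {y. x \<in> A \<and> (x, y) \<in> {(u, v). u \<in> A \<and> v \<in> A \<and> strict_comparable P u v}\<^sup>*}" (is "?l = ?r")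
proof (intro set_eqI iffI)
  fix y assume "y \<in> ?l"
  then obtain L :: nat and z where z: "z 0 = x" "z L = y" "\<forall>i\<le>L. z i \<in> A"
    "\<forall>i<L. strict_comparable P (z i) (z (Suc i))"
    unfolding conn_comp_def by auto
  then have "(x, y) \<in> {(u, v). u \<in> A \<and> v \<in> A \<and> strict_comparable P u v} ^^ L"
    unfolding relpow_fun_conv by (intro exI[of _ z]) auto
  then show "y \<in> ?r" using z by (auto intro: relpow_imp_rtrancl)
next
  fix y assume y: "y \<in> ?r"
  then obtain L z where z: "z 0 = x" "z L = y"
    "\<forall>i<L. (z i, z (Suc i)) \<in> {(u, v). u \<in> A \<and> v \<in> A \<and> strict_comparable P u v}"
    by (auto dest!: rtrancl_imp_relpow simp: relpow_fun_conv)
  have "z i \<in> A" if "i \<le> L" for i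
    using that z y by (cases i) auto
  then show "y \<in> ?l" using z unfolding conn_comp_def by auto
qed

text \<open>A path of ties cannot leave the fibre of \<open>x\<close>, and a tie is either reflexive
  or a strict comparability. Hence ties and the steps of \<open>conn_comp\<close> reach the same
  points from \<open>x\<close>.\<close>

lemma G_comp_eq:
  assumes "x \<in> Field P"
  shows "G_comp P \<xi> x = (tie P \<xi> \<union> (tie P \<xi>)\<inverse>)\<^sup>* `` {x}"
proof -
  let ?A = "{y \<in> Field P. \<xi> y = \<xi> x}"
  let ?E = "{(u, v). u \<in> ?A \<and> v \<in> ?A \<and> strict_comparable P u v}"
  have "(x, y) \<in> ?E\<^sup>*" if "(x, y) \<in> (tie P \<xi> \<union> (tie P \<xi>)\<inverse>)\<^sup>*" for y
  proof -
    from that have "(x, y) \<in> ?E\<^sup>* \<and> y \<in> ?A"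
    proof induction
      case (step u v)
      then have "v \<in> ?A" by (auto simp: tie_def intro: FieldI1 FieldI2)
      moreover have "u = v \<or> (u, v) \<in> ?E"
        using step \<open>v \<in> ?A\<close> by (auto simp: tie_def strict_comparable_def)
      ultimately show ?case using step by (auto intro: rtrancl_into_rtrancl)
    qed (use assms in auto)
    then show ?thesis by simp
  qed
  moreover have "?E \<subseteq> tie P \<xi> \<union> (tie P \<xi>)\<inverse>"
    by (auto simp: tie_def strict_comparable_def)
  ultimately show ?thesis
    unfolding G_comp_def conn_comp_eq_rtrancl using assms by (auto dest: rtrancl_mono)
qed

lemma G_comp_refl: "x \<in> Field P \<Longrightarrow> x \<in> G_comp P \<xi> x"
  by (simp add: G_comp_eq)

lemma G_comp_subset: "y \<in> G_comp P \<xi> x \<Longrightarrow> y \<in> Field P \<and> \<xi> y = \<xi> x"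
  unfolding G_comp_def conn_comp_def by blast

lemma G_comp_sameI:
  assumes "x \<in> Field P" "a \<in> G_comp P \<xi> x" "(a, u) \<in> P \<or> (u, a) \<in> P" "\<xi> u = \<xi> a"
  shows "u \<in> G_comp P \<xi> x"
  using assms by (auto simp: G_comp_eq tie_def intro: rtrancl_into_rtrancl)

text \<open>Two comparable points with the same value are joined by at most one step. This recovers
  the ties from the components.\<close>

lemma tie_iff_G_comp: "(x, y) \<in> tie P \<xi> \<longleftrightarrow> (x, y) \<in> P \<and> y \<in> G_comp P \<xi> x"
proof (cases "(x, y) \<in> P")
  case True
  then have x: "x \<in> Field P" by (rule FieldI1)
  have "y \<in> G_comp P \<xi> x" if "\<xi> x = \<xi> y"
    using G_comp_sameI[OF x G_comp_refl[OF x], of y \<xi>] True that by simp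
  then show ?thesis using True G_comp_subset[of y P \<xi> x] by (auto simp: tie_def)
qed (simp add: tie_def)

text \<open>Components are generated by ties, and ties are the comparable pairs inside components.
  The condition on a G-scheme thus becomes an equation between two relations, and maps can be sorted
  by their tie set.\<close>

lemma G_comp_eq_iff_tie_eq:
  "(\<forall>x\<in>Field P. G_comp P \<xi> x = G_comp P \<zeta> x) \<longleftrightarrow> tie P \<xi> = tie P \<zeta>"
proof
  assume "\<forall>x\<in>Field P. G_comp P \<xi> x = G_comp P \<zeta> x"
  then show "tie P \<xi> = tie P \<zeta>"
    by (auto simp: tie_iff_G_comp; metis FieldI1)
qed (simp add: G_comp_eq)

text \<open>By \<open>closed\<close>, a path of ties that starts in the image of \<open>f\<close>
  never leaves it, so it comes from a path in \<open>P\<close>. This serves both isomorphisms and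
  the inclusion of \<open>P\<close> into a larger poset.\<close>

lemma G_comp_embed:
  assumes x: "x \<in> Field P"
    and f: "\<And>u v. u \<in> Field P \<Longrightarrow> v \<in> Field P \<Longrightarrow> (f u, f v) \<in> P' \<longleftrightarrow> (u, v) \<in> P"
    and h: "\<And>u. u \<in> Field P \<Longrightarrow> h (f u) = k u"
    and fx: "f x \<in> Field P'"
    and closed: "\<And>u w. u \<in> Field P \<Longrightarrow> (f u, w) \<in> P' \<or> (w, f u) \<in> P' \<Longrightarrow> h w = k u \<Longrightarrow> w \<in> f ` Field P"
  shows "G_comp P' h (f x) = f ` G_comp P k x"
proof (intro equalityI subsetI)
  fix w assume "w \<in> G_comp P' h (f x)"
  then have "(f x, w) \<in> (tie P' h \<union> (tie P' h)\<inverse>)\<^sup>*" using fx by (simp add: G_comp_eq)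
  then show "w \<in> f ` G_comp P k x"
  proof induction
    case base
    then show ?case using x by (simp add: G_comp_refl)
  next
    case (step v w)
    from step.IH obtain u where u: "u \<in> G_comp P k x" "v = f u" by (rule imageE)
    have uF: "u \<in> Field P" using G_comp_subset[OF u(1)] by simp
    have vw: "(v, w) \<in> P' \<or> (w, v) \<in> P'" "h w = k u"
      using step.hyps(2) u(2) h[OF uF] by (auto simp: tie_def)
    then obtain u' where "u' \<in> Field P" "w = f u'" using closed[OF uF] u by auto
    then have "u' \<in> G_comp P k x"
      using vw u(2) f[of u u'] f[of u' u] uF h[of u'] by (intro G_comp_sameI[OF x u(1)]) auto
    then show ?case using \<open>w = f u'\<close> by simp
  qed
next
  fix w assume "w \<in> f ` G_comp P k x"
  then obtain u where w: "w = f u" and "(x, u) \<in> (tie P k \<union> (tie P k)\<inverse>)\<^sup>*"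
    using x by (auto simp: G_comp_eq)
  from this(2) have "f u \<in> G_comp P' h (f x)"
  proof induction
    case base
    then show ?case using fx by (simp add: G_comp_refl)
  next
    case (step u v)
    from step.hyps(2) have "u \<in> Field P" "v \<in> Field P" "(u, v) \<in> P \<or> (v, u) \<in> P" "k u = k v"
      by (auto simp: tie_def intro: FieldI1 FieldI2)
    then show ?case
      using f[of u v] f[of v u] h[of u] h[of v] by (intro G_comp_sameI[OF fx step.IH]) auto
  qed
  then show "w \<in> G_comp P' h (f x)" using w by simp
qed

section \<open>Transport along order isomorphisms\<close>

definition ord_iso :: "('p \<Rightarrow> 'q) \<Rightarrow> 'p rel \<Rightarrow> 'q rel \<Rightarrow> bool" where
  "ord_iso f P P' \<longleftrightarrow> bij_betw f (Field P) (Field P') \<and>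
     (\<forall>x\<in>Field P. \<forall>y\<in>Field P. (x, y) \<in> P \<longleftrightarrow> (f x, f y) \<in> P')"

lemma ord_isoD:
  assumes "ord_iso f P P'"
  shows "x \<in> Field P \<Longrightarrow> f x \<in> Field P'" "f ` Field P = Field P'" "inj_on f (Field P)"
    "x \<in> Field P \<Longrightarrow> y \<in> Field P \<Longrightarrow> (f x, f y) \<in> P' \<longleftrightarrow> (x, y) \<in> P"
  using assms by (auto simp: ord_iso_def bij_betw_def)

lemma ord_iso_inv:
  assumes "ord_iso f P P'"
  shows "ord_iso (inv_into (Field P) f) P' P"
  using assms unfolding ord_iso_def
  by (auto simp: bij_betw_inv_into bij_betw_inv_into_right bij_betwE[OF bij_betw_inv_into])

lemma ord_iso_trans: "ord_iso f A B \<Longrightarrow> ord_iso g B C \<Longrightarrow> ord_iso (g \<circ> f) A C"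
  unfolding ord_iso_def by (auto intro: bij_betw_trans simp: bij_betwE)

text \<open>As \<open>representatives\<close> speaks of posets on natural numbers, \<open>P\<close>
  is first copied along an enumeration of its points. The lemma makes hypotheses about
  \<open>Pr\<close> applicable to posets constructed on sum types.\<close>

lemma ex_representative:
  fixes P :: "'x rel" and Pr :: "'p rel set"
  assumes "representatives Pr" and P: "fin_poset P"
  obtains P' f where "P' \<in> Pr" "ord_iso f P P'"
proof -
  obtain g where g: "bij_betw g (Field P) {0..<card (Field P)}"
    using ex_bij_betw_finite_nat fin_posetD(1)[OF P] by blast
  then have inj: "inj_on g (Field P)" by (simp add: bij_betw_def)
  define N where "N = map_prod g g ` P"
  have FN: "Field N = g ` Field P"
    unfolding N_def Field_def by force
  have N: "(g x, g y) \<in> N \<longleftrightarrow> (x, y) \<in> P" if "x \<in> Field P" "y \<in> Field P" for x y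
    unfolding N_def using that inj by (auto intro: FieldI1 FieldI2 dest: inj_onD)
  have "ord_iso g P N"
    unfolding ord_iso_def using inj N by (auto simp: bij_betw_def FN)
  moreover have "fin_poset N"
  proof (rule fin_posetI)
    show "finite (Field N)" "Field N \<noteq> {}" using P by (auto simp: FN fin_poset_def)
    show "(x, x) \<in> N" if "x \<in> Field N" for x
      using that N fin_posetD(2)[OF P] by (auto simp: FN)
    show "(x, z) \<in> N" if "(x, y) \<in> N" "(y, z) \<in> N" for x y z
    proof -
      from that have "x \<in> Field N" "y \<in> Field N" "z \<in> Field N" by (auto intro: FieldI1 FieldI2)
      then show ?thesis using that N fin_posetD(3)[OF P] by (auto simp: FN)
    qed
    show "x = y" if "(x, y) \<in> N" "(y, x) \<in> N" for x y
    proof -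
      from that have "x \<in> Field N" "y \<in> Field N" by (auto intro: FieldI1 FieldI2)
      then obtain u v where "x = g u" "y = g v" "u \<in> Field P" "v \<in> Field P" by (auto simp: FN)
      then show ?thesis using that N fin_posetD(4)[OF P] by metis
    qed
  qed
  ultimately obtain P' f where "P' \<in> Pr" "ord_iso f N P'"
    using assms(1) unfolding representatives_def poset_iso_def ord_iso_def by meson
  then show thesis using that ord_iso_trans[OF \<open>ord_iso g P N\<close>] by blast
qed

definition pull :: "('p \<Rightarrow> 'q) \<Rightarrow> 'p rel \<Rightarrow> ('q \<Rightarrow> 'a) \<Rightarrow> 'p \<Rightarrow> 'a" where
  "pull f P \<xi> = restrict (\<xi> \<circ> f) (Field P)"

lemma pull_hom:
  assumes "ord_iso f P P'" "\<xi> \<in> hom P' A"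
  shows "pull f P \<xi> \<in> hom P A"
  using assms ord_isoD[OF assms(1)] unfolding pull_def hom_iff
  by (auto intro: FieldI1 FieldI2)

lemma tie_pull:
  assumes "ord_iso f P P'"
  shows "tie P (pull f P \<xi>) = {(x, y) \<in> P. (f x, f y) \<in> tie P' \<xi>}"
proof -
  have "(f x, f y) \<in> P'" "x \<in> Field P" "y \<in> Field P" if "(x, y) \<in> P" for x y
    using that ord_isoD(4)[OF assms, of x y] by (auto intro: FieldI1 FieldI2)
  then show ?thesis by (auto simp: pull_def tie_def)
qed

lemma pull_pull_inv:
  assumes "ord_iso f P P'" "\<xi> \<in> extensional (Field P)"
  shows "pull f P (pull (inv_into (Field P) f) P' \<xi>) = \<xi>"
  using assms ord_isoD[OF assms(1)]
  by (auto simp: pull_def fun_eq_iff extensional_def)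

lemma inj_on_pull:
  assumes "ord_iso f P P'"
  shows "inj_on (pull f P) (hom P' A)"
proof (rule inj_onI)
  fix \<xi> \<zeta> assume h: "\<xi> \<in> hom P' A" "\<zeta> \<in> hom P' A" "pull f P \<xi> = pull f P \<zeta>"
  have "\<xi> (f x) = \<zeta> (f x)" if "x \<in> Field P" for x
    using fun_cong[OF h(3), of x] that by (simp add: pull_def)
  then have "\<xi> y = \<zeta> y" if "y \<in> Field P'" for y
    using that ord_isoD(2)[OF assms, symmetric] by auto
  then show "\<xi> = \<zeta>" using h(1,2) by (auto simp: hom_iff intro: extensionalityI)
qed

text \<open>An isomorphism carries components to components and open down-sets and up-sets to such
  sets, and \<open>h\<close> after \<open>f\<close> agrees with \<open>k\<close>. So none of the
  three entries changes.\<close>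

lemma ev_of_iso:
  assumes f: "ord_iso f P P'" and x: "x \<in> Field P"
    and h: "\<And>u. u \<in> Field P \<Longrightarrow> h (f u) = k u"
  shows "\<alpha> P' h (f x) = \<alpha> P k x"
proof -
  note fD = ord_isoD[OF f]
  have "G_comp P' h (f x) = f ` G_comp P k x"
    using x fD h by (intro G_comp_embed) (auto intro: FieldI1 FieldI2)
  moreover have "down_open P' (f ` B) = f ` down_open P B"
    "up_open P' (f ` B) = f ` up_open P B" if B: "B \<subseteq> Field P" for B
  proof -
    have mem: "f u \<in> f ` B \<longleftrightarrow> u \<in> B" if "u \<in> Field P" for u
      using inj_on_image_mem_iff[OF fD(3) that B] .
    have "w \<in> down_open P' (f ` B) \<longleftrightarrow> w \<in> f ` down_open P B"
      "w \<in> up_open P' (f ` B) \<longleftrightarrow> w \<in> f ` up_open P B" for w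
      unfolding atomize_conj
    proof (cases "w \<in> Field P'")
      case True
      then obtain u where u: "u \<in> Field P" "w = f u" using fD(2) by blast
      have "w \<in> f ` C \<longleftrightarrow> u \<in> C" if "C \<subseteq> Field P" for C
        using inj_on_image_mem_iff[OF fD(3) u(1) that] u by simp
      moreover have "down_open P B \<subseteq> Field P" "up_open P B \<subseteq> Field P"
        by (auto simp: down_open_def up_open_def intro: FieldI1 FieldI2)
      moreover have "(f u, f b) \<in> P' \<longleftrightarrow> (u, b) \<in> P" "(f b, f u) \<in> P' \<longleftrightarrow> (b, u) \<in> P"
        if "b \<in> B" for b using fD(4) u that B by auto
      ultimately show "(w \<in> down_open P' (f ` B) \<longleftrightarrow> w \<in> f ` down_open P B) \<and>
          (w \<in> up_open P' (f ` B) \<longleftrightarrow> w \<in> f ` up_open P B)"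
        using u mem[OF u(1)] by (simp add: down_open_def up_open_def)
    next
      case False
      then have "w \<notin> f ` Field P" using fD(2) by blast
      then show "(w \<in> down_open P' (f ` B) \<longleftrightarrow> w \<in> f ` down_open P B) \<and>
          (w \<in> up_open P' (f ` B) \<longleftrightarrow> w \<in> f ` up_open P B)"
        using False by (auto simp: down_open_def up_open_def intro: FieldI1 FieldI2)
    qed
    then show "down_open P' (f ` B) = f ` down_open P B" "up_open P' (f ` B) = f ` up_open P B"
      by blast+
  qed
  moreover have "G_comp P k x \<subseteq> Field P" by (auto dest: G_comp_subset)
  moreover have "h ` f ` B = k ` B" if "B \<subseteq> Field P" for B
    using that h by (force simp: image_image)
  moreover have "down_open P B \<subseteq> Field P" "up_open P B \<subseteq> Field P" for B
    by (auto simp: down_open_def up_open_def intro: FieldI1 FieldI2)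
  ultimately show ?thesis using h x by (simp add: ev_of_def)
qed

section \<open>Gluing posets\<close>

text \<open>\<open>P\<close> stands beside \<open>M\<close> and below the part \<open>Q\<close> of
  \<open>M\<close>. With \<open>M = Q\<close> this is the ordinal sum of \<open>P\<close> and
  \<open>Q\<close>, realised on a sum type; with \<open>M = R \<oplus> Q\<close> it is
  \<open>(P + R) \<oplus> Q\<close>.\<close>

definition glue :: "'p rel \<Rightarrow> 'a rel \<Rightarrow> 'a rel \<Rightarrow> ('p + 'a) rel" where
  "glue P M Q = map_prod Inl Inl ` P \<union> map_prod Inr Inr ` M \<union> Inl ` Field P \<times> Inr ` Field Q"

lemma glue_simps [simp]:
  "(Inl x, Inl y) \<in> glue P M Q \<longleftrightarrow> (x, y) \<in> P"
  "(Inr a, Inr b) \<in> glue P M Q \<longleftrightarrow> (a, b) \<in> M"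
  "(Inl x, Inr b) \<in> glue P M Q \<longleftrightarrow> x \<in> Field P \<and> b \<in> Field Q"
  "(Inr a, Inl y) \<notin> glue P M Q"
  unfolding glue_def by auto

lemma Field_glue:
  assumes "Field Q \<subseteq> Field M"
  shows "Field (glue P M Q) = Inl ` Field P \<union> Inr ` Field M"
proof (rule set_eqI)
  fix w show "w \<in> Field (glue P M Q) \<longleftrightarrow> w \<in> Inl ` Field P \<union> Inr ` Field M"
  proof (cases w)
    case (Inl x)
    have "w \<in> Field (glue P M Q) \<longleftrightarrow>
        (\<exists>y. (x, y) \<in> P) \<or> (x \<in> Field P \<and> (\<exists>b. b \<in> Field Q)) \<or> (\<exists>y. (y, x) \<in> P)"
      unfolding Inl Field_def[of "glue P M Q"] by (simp add: Domain_iff Range_iff split_sum_ex)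
    then have "w \<in> Field (glue P M Q) \<longleftrightarrow> x \<in> Field P" by (auto simp: Field_def)
    then show ?thesis using Inl by auto
  next
    case (Inr a)
    have "w \<in> Field (glue P M Q) \<longleftrightarrow>
        (\<exists>b. (a, b) \<in> M) \<or> (\<exists>x. x \<in> Field P) \<and> a \<in> Field Q \<or> (\<exists>b. (b, a) \<in> M)"
      unfolding Inr Field_def[of "glue P M Q"] by (auto simp: Domain_iff Range_iff split_sum_ex)
    moreover have "a \<in> Field M \<longleftrightarrow> (\<exists>b. (a, b) \<in> M) \<or> (\<exists>b. (b, a) \<in> M)"
      by (auto simp: Field_def)
    ultimately have "w \<in> Field (glue P M Q) \<longleftrightarrow> a \<in> Field M" using assms by blast
    then show ?thesis using Inr by auto
  qed
qed

text \<open>Transitivity is the point: if \<open>x\<close> in \<open>P\<close> lies below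
  \<open>q\<close> in \<open>Q\<close>, and \<open>m\<close> lies above \<open>q\<close> in
  \<open>M\<close>, then \<open>m\<close> has to be in \<open>Q\<close>, which \<open>up\<close>
  supplies.\<close>

lemma fin_poset_glue:
  assumes M: "fin_poset M" and fin: "finite (Field P)" and P: "Partial_order P"
    and QM: "Field Q \<subseteq> Field M"
    and up: "\<And>q m. q \<in> Field Q \<Longrightarrow> (q, m) \<in> M \<Longrightarrow> m \<in> Field Q"
  shows "fin_poset (glue P M Q)"
proof (rule fin_posetI)
  note P' = partial_orderD[OF P]
  note M' = fin_posetD[OF M]
  show "finite (Field (glue P M Q))" "Field (glue P M Q) \<noteq> {}"
    using M fin by (auto simp: Field_glue[OF QM] fin_poset_def)
  show "(x, x) \<in> glue P M Q" if "x \<in> Field (glue P M Q)" for x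
    using that P' M' by (auto simp: Field_glue[OF QM])
  show "(x, z) \<in> glue P M Q" if "(x, y) \<in> glue P M Q" "(y, z) \<in> glue P M Q" for x y z
    using that by (cases x; cases y; cases z) (auto dest: FieldI1 intro: P'(2) M'(3) up)
  show "x = y" if "(x, y) \<in> glue P M Q" "(y, x) \<in> glue P M Q" for x y
    using that P'(3) M'(4) by (cases x; cases y) auto
qed

text \<open>By \<open>ne\<close>, no point of \<open>Q\<close> joins a component of
  \<open>P\<close>, and nothing in \<open>M\<close> lies below a point of \<open>P\<close>.
  Components are nonempty, so all of \<open>Q\<close> lies above each of them, and only the third
  entry grows.\<close>

lemma ev_of_glue:
  assumes x: "x \<in> Field P" and QM: "Field Q \<subseteq> Field M"
    and h: "\<And>u. u \<in> Field P \<Longrightarrow> h (Inl u) = k u"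
    and ne: "\<And>u q. u \<in> Field P \<Longrightarrow> q \<in> Field Q \<Longrightarrow> h (Inr q) \<noteq> k u"
  shows "\<alpha> (glue P M Q) h (Inl x) =
    (k x, k ` down_open P (G_comp P k x), k ` up_open P (G_comp P k x) \<union> (\<lambda>q. h (Inr q)) ` Field Q)"
proof -
  let ?W = "glue P M Q" and ?G = "G_comp P k x"
  have G: "G_comp ?W h (Inl x) = Inl ` ?G"
  proof (rule G_comp_embed)
    fix u w assume "u \<in> Field P" "(Inl u, w) \<in> ?W \<or> (w, Inl u) \<in> ?W" "h w = k u"
    then show "w \<in> Inl ` Field P"
      using ne[of u] by (cases w) (auto intro: FieldI1 FieldI2)
  qed (use x h in \<open>auto simp: Field_glue[OF QM]\<close>)
  have GF: "?G \<subseteq> Field P" "x \<in> ?G" using G_comp_refl[OF x] by (auto dest: G_comp_subset)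
  have "w \<in> down_open ?W (Inl ` ?G) \<longleftrightarrow> w \<in> Inl ` down_open P ?G" for w
    by (cases w) (auto simp: down_open_def)
  then have "down_open ?W (Inl ` ?G) = Inl ` down_open P ?G" by blast
  moreover have "w \<in> up_open ?W (Inl ` ?G) \<longleftrightarrow> w \<in> Inl ` up_open P ?G \<union> Inr ` Field Q" for w
    using GF by (cases w) (auto simp: up_open_def)
  then have "up_open ?W (Inl ` ?G) = Inl ` up_open P ?G \<union> Inr ` Field Q" by blast
  moreover have "h ` Inl ` B = k ` B" if "B \<subseteq> Field P" for B
    using that h by (force simp: image_image)
  moreover have "down_open P B \<subseteq> Field P" "up_open P B \<subseteq> Field P" for B
    by (auto simp: down_open_def up_open_def intro: FieldI1 FieldI2)
  ultimately show ?thesis using h x G by (simp add: ev_of_def image_Un image_image)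
qed

section \<open>Cancellation for G-schemes\<close>

definition tie_embeds :: "'p rel \<Rightarrow> 'a rel \<Rightarrow> 'b rel \<Rightarrow> bool" where
  "tie_embeds P A B \<longleftrightarrow> (\<exists>\<rho> \<in> hom P A \<rightarrow> hom P B. inj_on \<rho> (hom P A) \<and>
     (\<forall>\<xi>\<in>hom P A. tie P (\<rho> \<xi>) = tie P \<xi>))"

text \<open>The maps of a G-scheme for different posets are unrelated, so they can be chosen for
  each \<open>P\<close> in \<open>Pr\<close> separately.\<close>

lemma G_below_iff: "G_below Pr A B \<longleftrightarrow> (\<forall>P\<in>Pr. tie_embeds P A B)"
proof -
  have "G_below Pr A B \<longleftrightarrow> (\<exists>\<rho>. \<forall>P\<in>Pr. \<rho> P \<in> hom P A \<rightarrow> hom P B \<and> inj_on (\<rho> P) (hom P A) \<and>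
     (\<forall>\<xi>\<in>hom P A. tie P (\<rho> P \<xi>) = tie P \<xi>))"
    unfolding G_below_def G_scheme_def hom_scheme_def strong_scheme_def G_comp_eq_iff_tie_eq
    by blast
  then show ?thesis unfolding tie_embeds_def Bex_def by (simp only: bchoice_iff)
qed

lemma tie_embeds_iso:
  assumes f: "ord_iso f P P'" and "tie_embeds P' A B"
  shows "tie_embeds P A B"
proof -
  obtain \<rho> where \<rho>: "\<rho> \<in> hom P' A \<rightarrow> hom P' B" "inj_on \<rho> (hom P' A)"
    "\<And>\<xi>. \<xi> \<in> hom P' A \<Longrightarrow> tie P' (\<rho> \<xi>) = tie P' \<xi>"
    using assms(2) unfolding tie_embeds_def by blast
  let ?g = "pull (inv_into (Field P) f) P'"
  note g = pull_hom[OF ord_iso_inv[OF f]]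
  have gi: "pull f P (?g \<xi>) = \<xi>" if "\<xi> \<in> hom P A" for \<xi>
    using that by (intro pull_pull_inv[OF f]) (simp add: hom_iff)
  have "inj_on (\<lambda>\<xi>. pull f P (\<rho> (?g \<xi>))) (hom P A)"
  proof (rule inj_onI)
    fix \<xi> \<zeta> assume h: "\<xi> \<in> hom P A" "\<zeta> \<in> hom P A" "pull f P (\<rho> (?g \<xi>)) = pull f P (\<rho> (?g \<zeta>))"
    then have "\<rho> (?g \<xi>) = \<rho> (?g \<zeta>)"
      using inj_onD[OF inj_on_pull[OF f]] \<rho>(1) g by (metis Pi_mem)
    then have "?g \<xi> = ?g \<zeta>" using inj_onD[OF \<rho>(2)] g h by blast
    then show "\<xi> = \<zeta>" using gi h by metis
  qed
  moreover have "tie P (pull f P (\<rho> (?g \<xi>))) = tie P \<xi>" if "\<xi> \<in> hom P A" for \<xi>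
    using \<rho>(3)[OF g[OF that]] gi[OF that] tie_pull[OF f, of "?g \<xi>"] tie_pull[OF f, of "\<rho> (?g \<xi>)"]
    by simp
  moreover have "(\<lambda>\<xi>. pull f P (\<rho> (?g \<xi>))) \<in> hom P A \<rightarrow> hom P B"
    by (intro Pi_I pull_hom[OF f] Pi_mem[OF \<rho>(1)] g)
  ultimately show ?thesis unfolding tie_embeds_def by blast
qed

section \<open>Counting maps with a given tie set\<close>

definition tie_homs :: "'p rel \<Rightarrow> 'a rel \<Rightarrow> 'p rel \<Rightarrow> ('p \<Rightarrow> 'a) set" where
  "tie_homs P A T = {\<xi> \<in> hom P A. tie P \<xi> = T}"

lemma finite_tie_homs: "finite (Field P) \<Longrightarrow> finite (Field A) \<Longrightarrow> finite (tie_homs P A T)"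
  unfolding tie_homs_def by (rule finite_subset[OF _ finite_hom[of P A]]) blast+

text \<open>The sets \<open>tie_homs P A T\<close> partition \<open>hom P A\<close>. A
  tie-preserving injection restricts to each class. Conversely, injections of the classes can be
  pasted together, because the tie set of an image tells which class it came from.\<close>

lemma tie_embeds_iff_card:
  assumes "finite (Field P)" "finite (Field A)" "finite (Field B)"
  shows "tie_embeds P A B \<longleftrightarrow> (\<forall>T. card (tie_homs P A T) \<le> card (tie_homs P B T))"
proof
  have fin: "finite (tie_homs P A T)" "finite (tie_homs P B T)" for T
    using assms by (simp_all add: finite_tie_homs)
  {
    assume "tie_embeds P A B"
    then obtain \<rho> where "\<rho> \<in> hom P A \<rightarrow> hom P B" "inj_on \<rho> (hom P A)"
      "\<And>\<xi>. \<xi> \<in> hom P A \<Longrightarrow> tie P (\<rho> \<xi>) = tie P \<xi>"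
      unfolding tie_embeds_def by blast
    then show "\<forall>T. card (tie_homs P A T) \<le> card (tie_homs P B T)"
      by (intro allI card_inj_on_le[of \<rho>] fin) (auto simp: tie_homs_def inj_on_def)
  next
    assume "\<forall>T. card (tie_homs P A T) \<le> card (tie_homs P B T)"
    then have "\<forall>T. \<exists>r. r ` tie_homs P A T \<subseteq> tie_homs P B T \<and> inj_on r (tie_homs P A T)"
      using card_le_inj[OF fin] by meson
    then obtain r where r: "\<And>T. r T ` tie_homs P A T \<subseteq> tie_homs P B T"
      "\<And>T. inj_on (r T) (tie_homs P A T)" by metis
    define \<rho> where "\<rho> \<xi> = r (tie P \<xi>) \<xi>" for \<xi>
    have \<rho>: "\<rho> \<xi> \<in> hom P B" "tie P (\<rho> \<xi>) = tie P \<xi>" if "\<xi> \<in> hom P A" for \<xi>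
      using r(1)[of "tie P \<xi>"] that by (auto simp: \<rho>_def tie_homs_def)
    have "inj_on \<rho> (hom P A)"
    proof (rule inj_onI)
      fix \<xi> \<zeta> assume h: "\<xi> \<in> hom P A" "\<zeta> \<in> hom P A" "\<rho> \<xi> = \<rho> \<zeta>"
      then have "tie P \<xi> = tie P \<zeta>" using \<rho>(2) by metis
      then show "\<xi> = \<zeta>" using h inj_onD[OF r(2), of "tie P \<xi>" \<xi> \<zeta>]
        by (simp add: \<rho>_def tie_homs_def)
    qed
    then show "tie_embeds P A B" unfolding tie_embeds_def using \<rho> by blast
  }
qed

text \<open>If \<open>a\<close> were at least \<open>b + 1\<close> with \<open>b > 0\<close>, then
  \<open>C\<close> would bound all powers of \<open>1 + 1/b\<close>, which are unbounded by
  Bernoulli's inequality. For \<open>b = 0\<close> the exponent 1 gives the contradiction.\<close>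

lemma le_of_power_le_power_mult:
  fixes a b C :: nat
  assumes "\<And>n. a ^ n \<le> b ^ n * C"
  shows "a \<le> b"
proof (rule ccontr)
  assume "\<not> a \<le> b"
  then have ba: "(b + 1) ^ n \<le> b ^ n * C" for n
    using assms[of n] power_mono[of "b + 1" a n] by simp
  \<comment> \<open>Bernoulli's inequality \<open>(1 + 1/b)^n \<ge> 1 + n/b\<close>, multiplied by
    \<open>b ^ (n + 1)\<close>.\<close>
  have bernoulli: "b ^ n * (b + n) \<le> b * (b + 1) ^ n" for n
  proof (induction n)
    case (Suc n)
    have "b ^ Suc n * (b + Suc n) \<le> b ^ n * (b + n) * (b + 1)" by (simp add: algebra_simps)
    also have "\<dots> \<le> b * (b + 1) ^ n * (b + 1)" using Suc by (rule mult_right_mono) simp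
    finally show ?case by (simp add: algebra_simps)
  qed simp
  \<comment> \<open>Chosen such that \<open>b + N\<close> exceeds \<open>b * C\<close>; after
    cancelling \<open>b ^ N\<close>, only \<open>b = 0\<close> remains possible.\<close>
  define N where "N = b * C + 1"
  have "b ^ N * (b + N) \<le> b * (b + 1) ^ N" by (rule bernoulli)
  also have "\<dots> \<le> b * (b ^ N * C)" using ba by (rule mult_left_mono) simp
  also have "\<dots> = b ^ N * (b * C)" by (rule mult.left_commute)
  finally have "b = 0 \<or> b + N \<le> b * C" by (auto simp: mult_le_cancel1)
  then have "b = 0" by (simp add: N_def)
  then show False using ba[of 1] by simp
qed

text \<open>Otherwise \<open>g\<close> would push a maximal \<open>q\<close> with \<open>q < g q\<close> strictly upwards.\<close>
lemma no_strict_map_above: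
  assumes Q: "fin_poset Q" and q0: "q0 \<in> Field Q"
    and above: "\<And>q. q \<in> Field Q \<Longrightarrow> (q0, g q) \<in> Q \<and> q0 \<noteq> g q"
    and strict: "\<And>q q'. (q, q') \<in> Q \<Longrightarrow> q \<noteq> q' \<Longrightarrow> (g q, g q') \<in> Q \<and> g q \<noteq> g q'"
  shows False
proof -
  note QD = fin_posetD[OF Q]
  let ?C = "{q \<in> Field Q. (q, g q) \<in> Q \<and> q \<noteq> g q}"
  have "\<exists>m\<in>?C. \<forall>x\<in>?C. x \<noteq> m \<longrightarrow> \<not> ((m, x) \<in> Q \<and> m \<noteq> x)"
  proof (rule Finite_Set.bex_max_element)
    show "asymp_on ?C (\<lambda>m x. (m, x) \<in> Q \<and> m \<noteq> x)" using QD(4) by (auto intro: asymp_onI)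
    show "transp_on ?C (\<lambda>m x. (m, x) \<in> Q \<and> m \<noteq> x)" using QD(3,4) by (intro transp_onI) blast
    show "?C \<noteq> {}" using above q0 by blast
  qed (use QD(1) in simp)
  then obtain m where m: "m \<in> ?C" "\<And>x. x \<in> ?C \<Longrightarrow> x \<noteq> m \<Longrightarrow> (m, x) \<notin> Q" by blast
  have "g m \<in> ?C" using m(1) strict[of m "g m"] FieldI2[of m "g m" Q] by simp
  from m(2)[OF this] show False using m(1) by auto
qed

section \<open>Disjoint copies of a poset below \<open>Q\<close>\<close>

definition copies :: "nat \<Rightarrow> 'p rel \<Rightarrow> (nat \<times> 'p) rel" where
  "copies n P = {((i, x), (i, y)) | i x y. i < n \<and> (x, y) \<in> P}"

lemma copies_iff: "((i, x), (j, y)) \<in> copies n P \<longleftrightarrow> i = j \<and> i < n \<and> (x, y) \<in> P"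
  unfolding copies_def by auto

lemma Field_copies: "Field (copies n P) = {..<n} \<times> Field P"
proof -
  have "(i, x) \<in> Field (copies n P) \<longleftrightarrow> i < n \<and> x \<in> Field P" for i x
    by (auto simp: Field_def Domain_iff Range_iff copies_iff)
  then show ?thesis by auto
qed

lemma Partial_order_copies:
  assumes "Partial_order P"
  shows "Partial_order (copies n P)"
proof -
  note PD = partial_orderD[OF assms]
  show ?thesis
    unfolding partial_order_on_def preorder_on_def
  proof (intro conjI)
    show "refl_on (Field (copies n P)) (copies n P)"
      by (intro refl_onI) (auto simp: Field_copies copies_iff PD(1))
    show "trans (copies n P)"
      by (intro transI) (auto simp: copies_iff intro: PD(2))
    show "antisym (copies n P)"
      by (intro antisymI) (auto simp: copies_iff intro: PD(3))
  qed (auto intro: FieldI1 FieldI2)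
qed

abbreviation copies_sum :: "nat \<Rightarrow> 'p rel \<Rightarrow> 'a rel \<Rightarrow> ((nat \<times> 'p) + 'a) rel" where
  "copies_sum n P Q \<equiv> glue (copies n P) Q Q"

text \<open>Reflexive pairs of an order are ties of every map, so the diagonal of \<open>Q\<close>
  has to occur. A map with this tie set is strict on \<open>Q\<close> and between the copies and
  \<open>Q\<close>.\<close>

definition copies_tie :: "nat \<Rightarrow> 'p rel \<Rightarrow> 'a rel \<Rightarrow> ((nat \<times> 'p) + 'a) rel" where
  "copies_tie n T Q = map_prod Inl Inl ` copies n T \<union> (\<lambda>q. (Inr q, Inr q)) ` Field Q"

lemma copies_tie_simps [simp]:
  "(Inl x, Inl y) \<in> copies_tie n T Q \<longleftrightarrow> (x, y) \<in> copies n T"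
  "(Inr a, Inr b) \<in> copies_tie n T Q \<longleftrightarrow> a = b \<and> a \<in> Field Q"
  "(Inl x, Inr b) \<notin> copies_tie n T Q"
  "(Inr a, Inl y) \<notin> copies_tie n T Q"
  unfolding copies_tie_def by auto

lemma tie_homsD:
  assumes "\<xi> \<in> tie_homs P A T"
  shows "\<xi> \<in> extensional (Field P)" "x \<in> Field P \<Longrightarrow> \<xi> x \<in> Field A"
    "(x, y) \<in> P \<Longrightarrow> (\<xi> x, \<xi> y) \<in> A" "(x, y) \<in> P \<Longrightarrow> \<xi> x = \<xi> y \<longleftrightarrow> (x, y) \<in> T"
  using assms by (auto simp: tie_homs_def hom_iff tie_def)

lemma tie_homsI:
  assumes "\<xi> \<in> extensional (Field P)" "\<And>x. x \<in> Field P \<Longrightarrow> \<xi> x \<in> Field A"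
    "\<And>x y. (x, y) \<in> P \<Longrightarrow> (\<xi> x, \<xi> y) \<in> A" "\<And>x y. (x, y) \<in> P \<Longrightarrow> \<xi> x = \<xi> y \<longleftrightarrow> (x, y) \<in> T" "T \<subseteq> P"
  shows "\<xi> \<in> tie_homs P A T"
  using assms by (auto simp: tie_homs_def hom_iff tie_def)

text \<open>Maps with tie set \<open>T\<close> are chosen independently, one for each copy, and
  \<open>Q\<close> is mapped identically. As \<open>Q\<close> and \<open>R\<close> are disjoint, no
  tie arises between a copy and \<open>Q\<close>.\<close>

lemma card_tie_homs_power_le:
  fixes P :: "'p rel" and Q R :: "'a rel"
  assumes Q: "fin_poset Q" and fin: "finite (Field P)" "finite (Field R)"
    and disj: "Field Q \<inter> Field R = {}" and T: "T \<subseteq> P"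
  shows "card (tie_homs P R T) ^ n
    \<le> card (tie_homs (copies_sum n P Q) (R \<oplus> Q) (copies_tie n T Q))" (is "_ \<le> card ?H")
proof -
  let ?W = "copies_sum n P Q"
  note FW = Field_glue[OF order_refl[of "Field Q"], where P = "copies n P"]
  define F where "F \<Phi> = (\<lambda>w\<in>Field ?W. case w of Inl (i, x) \<Rightarrow> \<Phi> i x | Inr q \<Rightarrow> q)"
    for \<Phi> :: "nat \<Rightarrow> 'p \<Rightarrow> 'a"
  have F1: "F \<Phi> (Inl (i, x)) = \<Phi> i x" if "i < n" "x \<in> Field P" for \<Phi> i x
    using that by (auto simp: F_def FW Field_copies)
  have F2: "F \<Phi> (Inr q) = q" if "q \<in> Field Q" for \<Phi> q
    using that by (auto simp: F_def FW Field_copies)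
  let ?D = "PiE {..<n} (\<lambda>_. tie_homs P R T)"
  have "F \<Phi> \<in> ?H" if \<Phi>: "\<Phi> \<in> ?D" for \<Phi>
  proof (rule tie_homsI)
    have \<Phi>i: "\<Phi> i \<in> tie_homs P R T" if "i < n" for i using \<Phi> that by auto
    note \<Phi>D = tie_homsD[OF \<Phi>i]
    show "F \<Phi> \<in> extensional (Field ?W)" by (simp add: F_def)
    show "F \<Phi> w \<in> Field (R \<oplus> Q)" if "w \<in> Field ?W" for w
      using that \<Phi>D(2) by (auto simp: FW Field_copies Field_ord_sum F1 F2)
    have "(F \<Phi> w, F \<Phi> v) \<in> R \<oplus> Q \<and> (F \<Phi> w = F \<Phi> v \<longleftrightarrow> (w, v) \<in> copies_tie n T Q)"
      if wv: "(w, v) \<in> ?W" for w v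
    proof (cases w)
      case (Inl w')
      obtain i x where w: "w = Inl (i, x)" using Inl by (cases w') auto
      then have ix: "i < n" "x \<in> Field P"
        using FieldI1[OF wv] by (auto simp: FW Field_copies)
      show ?thesis
      proof (cases v)
        case (Inl v')
        then obtain y where v: "v = Inl (i, y)" "(x, y) \<in> P"
          using wv w by (cases v') (auto simp: copies_iff)
        then show ?thesis
          using w ix \<Phi>D(3,4)[OF ix(1) v(2)] FieldI2[OF v(2)] by (auto simp: F1 copies_iff ord_sum_iff)
      next
        case (Inr q)
        then have "q \<in> Field Q" using wv w by simp
        then show ?thesis using w Inr ix \<Phi>D(2)[OF ix] disj by (auto simp: F1 F2 ord_sum_iff)
      qed
    next
      case (Inr q)
      then obtain q' where v: "v = Inr q'" "(q, q') \<in> Q" using wv by (cases v) auto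
      then show ?thesis using Inr by (auto simp: F2 ord_sum_iff FieldI1 FieldI2)
    qed
    then show "(F \<Phi> w, F \<Phi> v) \<in> R \<oplus> Q" "F \<Phi> w = F \<Phi> v \<longleftrightarrow> (w, v) \<in> copies_tie n T Q"
      if "(w, v) \<in> ?W" for w v using that by auto
    show "copies_tie n T Q \<subseteq> ?W"
      using T fin_posetD(2)[OF Q] by (auto simp: copies_tie_def copies_def)
  qed
  moreover have "inj_on F ?D"
  proof (rule inj_onI)
    fix \<Phi> \<Psi> assume h: "\<Phi> \<in> ?D" "\<Psi> \<in> ?D" "F \<Phi> = F \<Psi>"
    have "\<Phi> i = \<Psi> i" if i: "i \<in> {..<n}" for i
    proof (rule extensionalityI)
      show "\<Phi> i \<in> extensional (Field P)" "\<Psi> i \<in> extensional (Field P)"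
        using h i by (auto simp: PiE_iff dest: tie_homsD(1))
      show "\<Phi> i x = \<Psi> i x" if "x \<in> Field P" for x
        using fun_cong[OF h(3), of "Inl (i, x)"] i that by (simp add: F1)
    qed
    then show "\<Phi> = \<Psi>" using h by (intro PiE_ext) auto
  qed
  moreover have "finite ?H"
    by (rule finite_tie_homs) (simp_all add: FW Field_copies Field_ord_sum fin fin_posetD(1)[OF Q])
  ultimately have "card ?D \<le> card ?H" by (intro card_inj_on_le[of F]) auto
  then show ?thesis by (simp add: card_PiE)
qed

text \<open>A map is determined by its restrictions to the copies and to \<open>Q\<close>. The
  former have values in \<open>S\<close>, which gives the power; for the latter the crude count of
  all functions suffices, since it does not depend on \<open>n\<close>.\<close>

lemma card_tie_homs_le_power:
  fixes P :: "'p rel" and Q S :: "'a rel"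
  assumes Q: "fin_poset Q" and fin: "finite (Field P)" "finite (Field S)"
    and disj: "Field Q \<inter> Field S = {}" and T: "T \<subseteq> P"
  shows "card (tie_homs (copies_sum n P Q) (S \<oplus> Q) (copies_tie n T Q))
    \<le> card (tie_homs P S T) ^ n * card (Field Q \<rightarrow>\<^sub>E Field (S \<oplus> Q))" (is "card ?H \<le> _")
proof -
  let ?W = "copies_sum n P Q"
  note FW = Field_glue[OF order_refl[of "Field Q"], where P = "copies n P"]
  define F where "F \<zeta> = (\<lambda>i\<in>{..<n}. \<lambda>x\<in>Field P. \<zeta> (Inl (i, x)))"
    for \<zeta> :: "(nat \<times> 'p) + 'a \<Rightarrow> 'a"
  define K where "K \<zeta> = (\<lambda>q\<in>Field Q. \<zeta> (Inr q))" for \<zeta> :: "(nat \<times> 'p) + 'a \<Rightarrow> 'a"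
  let ?D = "PiE {..<n} (\<lambda>_. tie_homs P S T)" and ?E = "Field Q \<rightarrow>\<^sub>E Field (S \<oplus> Q)"
  have FF: "F \<zeta> \<in> ?D" and KK: "K \<zeta> \<in> ?E" if \<zeta>: "\<zeta> \<in> ?H" for \<zeta>
  proof -
    note \<zeta>D = tie_homsD[OF \<zeta>]
    show "K \<zeta> \<in> ?E" using \<zeta>D(2) by (auto simp: K_def FW)
    \<comment> \<open>If a point of a copy went to \<open>?q0\<close> in \<open>Q\<close>, all of
      \<open>Q\<close> would go strictly above \<open>?q0\<close>. As \<open>Q\<close> is an up-set
      of \<open>S \<oplus> Q\<close>, this would be a strict map of \<open>Q\<close> to itself,
      contrary to \<open>no_strict_map_above\<close>.\<close>
    have S: "\<zeta> (Inl (i, x)) \<in> Field S" if ix: "i < n" "x \<in> Field P" for i x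
    proof (rule ccontr)
      let ?q0 = "\<zeta> (Inl (i, x))"
      assume "?q0 \<notin> Field S"
      then have q0: "?q0 \<in> Field Q"
        using \<zeta>D(2)[of "Inl (i, x)"] ix by (auto simp: FW Field_copies Field_ord_sum)
      have up: "(a, b) \<in> Q" if "(a, b) \<in> S \<oplus> Q" "a \<in> Field Q" for a b
        using that disj by (auto simp: ord_sum_iff dest: FieldI1)
      have above: "(?q0, \<zeta> (Inr q)) \<in> Q \<and> ?q0 \<noteq> \<zeta> (Inr q)" if "q \<in> Field Q" for q
        using \<zeta>D(3,4)[of "Inl (i, x)" "Inr q"] that ix up q0 by (simp add: Field_copies)
      have "(\<zeta> (Inr q), \<zeta> (Inr q')) \<in> Q \<and> \<zeta> (Inr q) \<noteq> \<zeta> (Inr q')" if "(q, q') \<in> Q" "q \<noteq> q'" for q q'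
        using \<zeta>D(3,4)[of "Inr q" "Inr q'"] that above[OF FieldI1[OF that(1)]] up
        by (auto dest: FieldI2)
      with above show False
        by (rule no_strict_map_above[OF Q q0])
    qed
    have "(\<lambda>x\<in>Field P. \<zeta> (Inl (i, x))) \<in> tie_homs P S T" if i: "i < n" for i
    proof (rule tie_homsI)
      fix x y assume xy: "(x, y) \<in> P"
      then have f: "x \<in> Field P" "y \<in> Field P" by (auto intro: FieldI1 FieldI2)
      have "(\<zeta> (Inl (i, x)), \<zeta> (Inl (i, y))) \<in> S \<oplus> Q" 
        "\<zeta> (Inl (i, x)) = \<zeta> (Inl (i, y)) \<longleftrightarrow> (x, y) \<in> T"
        using \<zeta>D(3,4)[of "Inl (i, x)" "Inl (i, y)"] i xy by (auto simp: copies_iff)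
      moreover have "\<zeta> (Inl (i, x)) \<notin> Field Q" "\<zeta> (Inl (i, y)) \<notin> Field Q" using S[OF i] f disj by auto
      ultimately show "((\<lambda>x\<in>Field P. \<zeta> (Inl (i, x))) x, (\<lambda>x\<in>Field P. \<zeta> (Inl (i, x))) y) \<in> S"
        "(\<lambda>x\<in>Field P. \<zeta> (Inl (i, x))) x = (\<lambda>x\<in>Field P. \<zeta> (Inl (i, x))) y \<longleftrightarrow> (x, y) \<in> T"
        using f by (auto simp: ord_sum_iff dest: FieldI1)
    qed (use S i T in auto)
    then show "F \<zeta> \<in> ?D" by (simp add: F_def)
  qed
  have "inj_on (\<lambda>\<zeta>. (F \<zeta>, K \<zeta>)) ?H"
  proof (rule inj_onI)
    fix \<xi> \<zeta> assume h: "\<xi> \<in> ?H" "\<zeta> \<in> ?H" "(F \<xi>, K \<xi>) = (F \<zeta>, K \<zeta>)"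
    show "\<xi> = \<zeta>"
    proof (rule extensionalityI[OF tie_homsD(1)[OF h(1)] tie_homsD(1)[OF h(2)]])
      fix w assume "w \<in> Field ?W"
      then consider i x where "w = Inl (i, x)" "i < n" "x \<in> Field P" | q where "w = Inr q" "q \<in> Field Q"
        by (auto simp: FW Field_copies)
      then show "\<xi> w = \<zeta> w"
      proof cases
        case 1
        have "F \<xi> i x = F \<zeta> i x" using h(3) by simp
        then show ?thesis using 1 by (simp add: F_def)
      next
        case 2
        have "K \<xi> q = K \<zeta> q" using h(3) by simp
        then show ?thesis using 2 by (simp add: K_def)
      qed
    qed
  qed
  moreover have "finite (tie_homs P S T)"
    using fin by (rule finite_tie_homs)
  then have "finite (?D \<times> ?E)"
    using fin(2) fin_posetD(1)[OF Q] by (auto intro!: finite_PiE simp: Field_ord_sum)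
  ultimately have "card ?H \<le> card (?D \<times> ?E)"
    using FF KK by (intro card_inj_on_le[of "\<lambda>\<zeta>. (F \<zeta>, K \<zeta>)"]) auto
  then show ?thesis by (simp add: card_cartesian_product card_PiE)
qed

lemma G_below_cancel:
  fixes Pr :: "'p rel set" and Q R S :: "'a rel"
  assumes Pr: "representatives Pr"
    and Q: "fin_poset Q" and R: "fin_poset R" and S: "fin_poset S"
    and disj: "Field Q \<inter> Field R = {}" "Field Q \<inter> Field S = {}"
    and below: "G_below Pr (R \<oplus> Q) (S \<oplus> Q)"
  shows "G_below Pr R S"
  unfolding G_below_iff
proof
  fix P assume "P \<in> Pr"
  then have P: "fin_poset P" using Pr by (simp add: representatives_def)
  note fin = fin_posetD(1)[OF P] fin_posetD(1)[OF R] fin_posetD(1)[OF S]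
  have "card (tie_homs P R T) \<le> card (tie_homs P S T)" for T
  proof (cases "T \<subseteq> P")
    case True
    show ?thesis
    proof (rule le_of_power_le_power_mult)
      fix n
      let ?W = "copies_sum n P Q"
      have W: "fin_poset ?W"
      proof (rule fin_poset_glue[OF Q])
        show "Partial_order (copies n P)"
          using P by (intro Partial_order_copies) (simp add: fin_poset_def)
        show "finite (Field (copies n P))" using fin(1) by (simp add: Field_copies)
      qed (auto dest: FieldI2)
      \<comment> \<open>The hypothesis \<open>below\<close> applies to the representative of
        \<open>?W\<close>; the injection it gives is carried back along \<open>f\<close>.\<close>
      obtain P' f where "P' \<in> Pr" and f: "ord_iso f ?W P'" using ex_representative[OF Pr W] .
      then have "tie_embeds P' (R \<oplus> Q) (S \<oplus> Q)" using below by (simp add: G_below_iff)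
      then have "tie_embeds ?W (R \<oplus> Q) (S \<oplus> Q)" by (rule tie_embeds_iso[OF f])
      then have "card (tie_homs ?W (R \<oplus> Q) (copies_tie n T Q)) \<le> card (tie_homs ?W (S \<oplus> Q) (copies_tie n T Q))"
        using fin fin_posetD(1)[OF W] fin_posetD(1)[OF Q]
        by (subst (asm) tie_embeds_iff_card) (auto simp: Field_ord_sum)
      then show "card (tie_homs P R T) ^ n
          \<le> card (tie_homs P S T) ^ n * card (Field Q \<rightarrow>\<^sub>E Field (S \<oplus> Q))"
        using card_tie_homs_power_le[OF Q fin(1,2) disj(1) True, of n]
          card_tie_homs_le_power[OF Q fin(1,3) disj(2) True, of n] by linarith
    qed
  next
    case False
    then have "tie_homs P R T = {}" by (auto simp: tie_homs_def tie_def)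
    then show ?thesis by simp
  qed
  then show "tie_embeds P R S" using tie_embeds_iff_card[OF fin] by blast
qed

section \<open>Cancellation for I-schemes\<close>

text \<open>A point below or above a component but outside it has a different value, since otherwise
  it would belong to the component. Hence monotonicity gives strict comparability of the
  values.\<close>

lemma ev_of_mem_EV:
  assumes \<xi>: "\<xi> \<in> hom P A" and x: "x \<in> Field P"
  shows "\<alpha> P \<xi> x \<in> EV A"
proof -
  have mono: "(\<xi> u, \<xi> v) \<in> A" if "(u, v) \<in> P" for u v using \<xi> that by (simp add: hom_iff)
  have "\<xi> u \<in> down_open A {\<xi> x}" if u: "u \<in> down_open P (G_comp P \<xi> x)" for u
  proof -
    obtain a where a: "a \<in> G_comp P \<xi> x" "(u, a) \<in> P" and nu: "u \<notin> G_comp P \<xi> x"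
      using u by (auto simp: down_open_def)
    then have "\<xi> u \<noteq> \<xi> a" using G_comp_sameI[OF x a(1)] by blast
    then show ?thesis using mono[OF a(2)] G_comp_subset[OF a(1)] by (simp add: down_open_def)
  qed
  moreover have "\<xi> u \<in> up_open A {\<xi> x}" if u: "u \<in> up_open P (G_comp P \<xi> x)" for u
  proof -
    obtain a where a: "a \<in> G_comp P \<xi> x" "(a, u) \<in> P" and nu: "u \<notin> G_comp P \<xi> x"
      using u by (auto simp: up_open_def)
    then have "\<xi> u \<noteq> \<xi> a" using G_comp_sameI[OF x a(1)] by blast
    then show ?thesis using mono[OF a(2)] G_comp_subset[OF a(1)] by (simp add: up_open_def)
  qed
  moreover have "\<xi> x \<in> Field A" using \<xi> x by (simp add: hom_iff)
  ultimately show ?thesis by (auto simp: EV_def ev_of_def)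
qed

text \<open>Comparable points with equal values share their component and hence their triple. With
  different values, each lies in the open down-set or up-set of the other's component, which yields
  \<open><\<^sub>+\<close>.\<close>

lemma ev_of_mono:
  assumes "(x, y) \<in> P"
  shows "\<alpha> P \<xi> x \<le>\<^sub>+ \<alpha> P \<xi> y"
proof -
  have F: "x \<in> Field P" "y \<in> Field P" using assms by (auto intro: FieldI1 FieldI2)
  show ?thesis
  proof (cases "\<xi> x = \<xi> y")
    case True
    then have t: "(x, y) \<in> tie P \<xi>" using assms by (simp add: tie_def)
    let ?E = "tie P \<xi> \<union> (tie P \<xi>)\<inverse>"
    have "(x, y) \<in> ?E" "(y, x) \<in> ?E" using t by auto
    then have "?E\<^sup>* `` {x} = ?E\<^sup>* `` {y}"
      by (auto intro: converse_rtrancl_into_rtrancl)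
    then have "G_comp P \<xi> x = G_comp P \<xi> y" using F by (simp add: G_comp_eq)
    then show ?thesis using True by (simp add: ev_le_def ev_of_def)
  next
    case False
    then have "x \<in> down_open P (G_comp P \<xi> y)" "y \<in> up_open P (G_comp P \<xi> x)"
      using assms F G_comp_refl[of y P \<xi>] G_comp_refl[of x P \<xi>]
        G_comp_subset[of x P \<xi> y] G_comp_subset[of y P \<xi> x]
      by (auto simp: down_open_def up_open_def)
    then show ?thesis by (simp add: ev_le_def ev_less_def ev_of_def)
  qed
qed

lemma EV_D:
  assumes "\<aa> \<in> EV A"
  shows "fst \<aa> \<in> Field A" "d \<in> fst (snd \<aa>) \<Longrightarrow> (d, fst \<aa>) \<in> A \<and> d \<noteq> fst \<aa>"
    "u \<in> snd (snd \<aa>) \<Longrightarrow> (fst \<aa>, u) \<in> A \<and> u \<noteq> fst \<aa>"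
  using assms by (auto simp: EV_def down_open_def up_open_def)

lemma EV_I:
  assumes "x \<in> Field A" "\<And>d. d \<in> D \<Longrightarrow> (d, x) \<in> A \<and> d \<noteq> x" "\<And>u. u \<in> U \<Longrightarrow> (x, u) \<in> A \<and> u \<noteq> x"
  shows "(x, D, U) \<in> EV A"
  using assms by (auto simp: EV_def down_open_def up_open_def)

lemma ev_less_mem:
  assumes "\<bb> \<in> EV A" "\<aa> <\<^sub>+ \<bb>"
  shows "(fst \<aa>, fst \<bb>) \<in> A" "fst \<aa> \<noteq> fst \<bb>"
  using assms EV_D(2)[OF assms(1)] by (auto simp: ev_less_def)

text \<open>The relation \<open>\<aa> <\<^sub>+ \<bb>\<close> forces different first entries, so
  injectivity of \<open>\<epsilon>\<close> excludes equality of the images.\<close>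

lemma ev_less_hom:
  assumes "ev_hom A B \<epsilon>" "inj_on \<epsilon> (EV A)" "\<aa> \<in> EV A" "\<bb> \<in> EV A" "\<aa> <\<^sub>+ \<bb>"
  shows "\<epsilon> \<aa> <\<^sub>+ \<epsilon> \<bb>"
proof -
  have "\<epsilon> \<aa> \<le>\<^sub>+ \<epsilon> \<bb>" using assms by (auto simp: ev_hom_def monotone_on_def ev_le_def)
  moreover have "\<epsilon> \<aa> \<noteq> \<epsilon> \<bb>"
    using ev_less_mem(2)[OF assms(4,5)] inj_onD[OF assms(2) _ assms(3,4)] by auto
  ultimately show ?thesis by (simp add: ev_le_def)
qed

section \<open>Triples enlarged by an upper part\<close>

text \<open>This is the change a triple undergoes when a poset with set of values \<open>V\<close>
  is put above everything.\<close>

definition add_up :: "'a set \<Rightarrow> 'a ev \<Rightarrow> 'a ev" where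
  "add_up V \<aa> = (fst \<aa>, fst (snd \<aa>), snd (snd \<aa>) \<union> V)"

lemma add_up_sel [simp]:
  "fst (add_up V \<aa>) = fst \<aa>" "fst (snd (add_up V \<aa>)) = fst (snd \<aa>)"
  "snd (snd (add_up V \<aa>)) = snd (snd \<aa>) \<union> V"
  by (simp_all add: add_up_def)

lemma add_up_inject:
  assumes "add_up V \<aa> = add_up V \<bb>" "snd (snd \<aa>) \<inter> V = {}" "snd (snd \<bb>) \<inter> V = {}"
  shows "\<aa> = \<bb>"
  using assms by (auto simp: add_up_def prod_eq_iff)

lemma ev_of_glue_add_up:
  assumes "x \<in> Field P" "Field Q \<subseteq> Field M" "\<And>u. u \<in> Field P \<Longrightarrow> h (Inl u) = k u"
    and "\<And>u q. u \<in> Field P \<Longrightarrow> q \<in> Field Q \<Longrightarrow> h (Inr q) \<noteq> k u"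
  shows "\<alpha> (glue P M Q) h (Inl x) = add_up ((\<lambda>q. h (Inr q)) ` Field Q) (\<alpha> P k x)"
  using ev_of_glue[where h = h and k = k, OF assms] by (simp add: add_up_def ev_of_def)

lemma EV_ord_sum_add_up:
  assumes "\<aa> \<in> EV R" "Field Q \<inter> Field R = {}"
  shows "add_up (Field Q) \<aa> \<in> EV (R \<oplus> Q)"
  unfolding add_up_def using EV_D[OF assms(1)] assms(2)
  by (intro EV_I) (auto simp: Field_ord_sum ord_sum_iff)

lemma EV_star_subset:
  assumes "Field Q \<inter> Field R = {}"
  shows "EV_star (Field R) Q \<subseteq> EV (R \<oplus> Q)"
proof
  fix \<aa> assume "\<aa> \<in> EV_star (Field R) Q"
  then obtain y D U where "\<aa> = (y, D \<union> Field R, U)" and "(y, D, U) \<in> EV Q"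
    by (auto simp: EV_star_def)
  then show "\<aa> \<in> EV (R \<oplus> Q)"
    using EV_D[of "(y, D, U)" Q] assms by (auto intro!: EV_I simp: Field_ord_sum ord_sum_iff)
qed

text \<open>The value of \<open>\<aa>\<close> lies in \<open>Field R\<close>, which every starred
  triple has in its second entry; the value of \<open>\<bb>\<close> lies in \<open>Field Q\<close>,
  which \<open>add_up\<close> puts into the third entry.\<close>

lemma add_up_less_EV_star:
  assumes "\<aa> \<in> EV R" "\<bb> \<in> EV_star (Field R) Q"
  shows "add_up (Field Q) \<aa> <\<^sub>+ \<bb>"
  using assms EV_D(1)[OF assms(1)] by (auto simp: EV_star_def ev_less_def EV_def)

text \<open>Triples are invariant under isomorphism, hence \<open>\<eta>\<close> commutes with
  transport. This extends the hypothesis on \<open>\<epsilon>\<close> from representatives to the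
  glued posets.\<close>

lemma ev_induced_iso:
  assumes f: "ord_iso f M P" and \<xi>: "\<xi> \<in> hom M A" and x: "x \<in> Field M"
    and eq: "\<And>\<zeta> y. \<zeta> \<in> hom P A \<Longrightarrow> y \<in> Field P \<Longrightarrow> \<alpha> P (\<eta> \<epsilon> P \<zeta>) y = \<epsilon> (\<alpha> P \<zeta> y)"
  shows "\<alpha> M (\<eta> \<epsilon> M \<xi>) x = \<epsilon> (\<alpha> M \<xi> x)"
proof -
  let ?\<zeta> = "pull (inv_into (Field M) f) P \<xi>"
  have \<zeta>: "?\<zeta> \<in> hom P A" using pull_hom[OF ord_iso_inv[OF f] \<xi>] .
  have fP: "f u \<in> Field P" if "u \<in> Field M" for u using ord_isoD(1)[OF f that] .
  have "?\<zeta> (f u) = \<xi> u" if "u \<in> Field M" for u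
    using that fP inv_into_f_f[OF ord_isoD(3)[OF f]] by (simp add: pull_def)
  then have \<alpha>: "\<alpha> P ?\<zeta> (f u) = \<alpha> M \<xi> u" if "u \<in> Field M" for u
    using ev_of_iso[OF f that] by blast
  then have "\<eta> \<epsilon> P ?\<zeta> (f u) = \<eta> \<epsilon> M \<xi> u" if "u \<in> Field M" for u
    using that fP by (simp add: ev_induced_def)
  then have "\<alpha> P (\<eta> \<epsilon> P ?\<zeta>) (f x) = \<alpha> M (\<eta> \<epsilon> M \<xi>) x"
    using ev_of_iso[OF f x] by blast
  then show ?thesis using eq[OF \<zeta> fP[OF x]] \<alpha>[OF x] by simp
qed

section \<open>Extending a map by the identity\<close>

definition glue_map :: "'p rel \<Rightarrow> 'a rel \<Rightarrow> 'a rel \<Rightarrow> ('p \<Rightarrow> 'a) \<Rightarrow> ('p + 'a) \<Rightarrow> 'a" where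
  "glue_map P M Q \<xi> = (\<lambda>w\<in>Field (glue P M Q). case_sum \<xi> id w)"

lemma glue_map_simps:
  assumes "Field Q \<subseteq> Field M"
  shows "u \<in> Field P \<Longrightarrow> glue_map P M Q \<xi> (Inl u) = \<xi> u" "m \<in> Field M \<Longrightarrow> glue_map P M Q \<xi> (Inr m) = m"
  by (simp_all add: glue_map_def Field_glue[OF assms])

lemma glue_map_hom:
  assumes "\<xi> \<in> hom P R"
  shows "glue_map P (R \<oplus> Q) Q \<xi> \<in> hom (glue P (R \<oplus> Q) Q) (R \<oplus> Q)" (is "?e \<in> hom ?W ?A")
proof -
  have QA: "Field Q \<subseteq> Field ?A" by (simp add: Field_ord_sum)
  note e = glue_map_simps[OF QA]
  have \<xi>: "\<xi> x \<in> Field R" if "x \<in> Field P" for x using assms that by (simp add: hom_iff)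
  have "?e w \<in> Field ?A" if "w \<in> Field ?W" for w
    using that \<xi> by (auto simp: Field_glue[OF QA] e Field_ord_sum)
  moreover have "(?e w, ?e v) \<in> ?A" if wv: "(w, v) \<in> ?W" for w v
  proof (cases w)
    case (Inl x)
    show ?thesis
    proof (cases v)
      case v: (Inl y)
      then have "(x, y) \<in> P" using wv Inl by simp
      then show ?thesis
        using assms FieldI1[of x y P] FieldI2[of x y P] by (simp add: Inl v e hom_iff ord_sum_iff)
    next
      case v: (Inr q)
      then have "x \<in> Field P" "q \<in> Field Q" using wv Inl by simp_all
      moreover from this have "q \<in> Field ?A" using QA by blast
      ultimately show ?thesis using \<xi> by (simp add: Inl v e ord_sum_iff)
    qed
  next
    case (Inr m)
    then obtain m' where v: "v = Inr m'" "(m, m') \<in> ?A" using wv by (cases v) simp_all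
    then show ?thesis using Inr FieldI1[of m m' ?A] FieldI2[of m m' ?A] by (simp add: e)
  qed
  moreover have "?e \<in> extensional (Field ?W)" by (simp add: glue_map_def)
  ultimately show ?thesis by (simp add: hom_iff)
qed

text \<open>The disjoint copy of \<open>R\<close> below \<open>Q\<close> makes these values independent of \<open>\<xi>\<close>.\<close>
lemma ev_of_glue_map_Inr:
  assumes \<xi>: "\<xi> \<in> hom P R" and q: "q \<in> Field Q" and Q: "Partial_order Q"
    and disj: "Field Q \<inter> Field R = {}"
  shows "\<alpha> (glue P (R \<oplus> Q) Q) (glue_map P (R \<oplus> Q) Q \<xi>) (Inr q) =
    (q, down_open Q {q} \<union> Field R, up_open Q {q})"
proof -
  let ?A = "R \<oplus> Q" let ?W = "glue P ?A Q" let ?e = "glue_map P ?A Q \<xi>"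
  have QA: "Field Q \<subseteq> Field ?A" by (simp add: Field_ord_sum)
  note e = glue_map_simps[OF QA]
  have \<xi>R: "\<xi> x \<in> Field R" if "x \<in> Field P" for x using \<xi> that by (simp add: hom_iff)
  have qA: "q \<in> Field ?A" using QA q by blast
  have qW: "Inr q \<in> Field ?W" using qA by (simp add: Field_glue[OF QA])
  have A: "(a, q) \<in> ?A \<longleftrightarrow> a \<in> Field R \<or> (a, q) \<in> Q" "(q, a) \<in> ?A \<longleftrightarrow> (q, a) \<in> Q" for a
    using q disj by (auto simp: ord_sum_iff dest: FieldI1 FieldI2)
  \<comment> \<open>The identity is injective and the values on \<open>P\<close> lie in
    \<open>R\<close>, so \<open>Inr q\<close> is tied to no other point and forms a component by
    itself.\<close>
  have "tie ?W ?e `` {Inr q} \<subseteq> {Inr q}" "(tie ?W ?e)\<inverse> `` {Inr q} \<subseteq> {Inr q}"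
  proof -
    have "w = Inr q" if "(Inr q, w) \<in> tie ?W ?e" for w
    proof (cases w)
      case (Inr b)
      then have "(q, b) \<in> ?A" "?e (Inr q) = ?e (Inr b)" using that by (simp_all add: tie_def)
      then show ?thesis using Inr qA FieldI2[of q b ?A] by (simp add: e)
    qed (use that in \<open>simp add: tie_def\<close>)
    moreover have "w = Inr q" if "(w, Inr q) \<in> tie ?W ?e" for w
    proof (cases w)
      case (Inl x)
      then have "x \<in> Field P" "?e (Inl x) = ?e (Inr q)" using that by (simp_all add: tie_def)
      then show ?thesis using qA \<xi>R[of x] disj q by (auto simp: e)
    next
      case (Inr a)
      then have "(a, q) \<in> ?A" "?e (Inr a) = ?e (Inr q)" using that by (simp_all add: tie_def)
      then show ?thesis using Inr qA FieldI1[of a q ?A] by (simp add: e)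
    qed
    ultimately show "tie ?W ?e `` {Inr q} \<subseteq> {Inr q}" "(tie ?W ?e)\<inverse> `` {Inr q} \<subseteq> {Inr q}" by blast+
  qed
  then have "(tie ?W ?e \<union> (tie ?W ?e)\<inverse>) `` {Inr q} \<subseteq> {Inr q}" by blast
  then have "(tie ?W ?e \<union> (tie ?W ?e)\<inverse>)\<^sup>* `` {Inr q} = {Inr q}"
    by (rule Image_closed_trancl)
  then have G: "G_comp ?W ?e (Inr q) = {Inr q}" using qW by (simp add: G_comp_eq)
  have eB: "?e ` Inr ` B = B" if "B \<subseteq> Field ?A" for B
  proof -
    have "(\<lambda>b. ?e (Inr b)) ` B = (\<lambda>b. b) ` B" using that by (intro image_cong) (auto simp: e)
    then show ?thesis by (simp add: image_image)
  qed
  have "down_open ?W {Inr q} = Inl ` Field P \<union> Inr ` (Field R \<union> down_open Q {q})"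
  proof (rule set_eqI)
    fix w show "w \<in> down_open ?W {Inr q} \<longleftrightarrow> w \<in> Inl ` Field P \<union> Inr ` (Field R \<union> down_open Q {q})"
      using q disj by (cases w) (auto simp: down_open_def A)
  qed
  moreover have "?e ` (Inl ` Field P \<union> Inr ` (Field R \<union> down_open Q {q})) = Field R \<union> down_open Q {q}"
  proof -
    have "?e ` Inl ` Field P \<subseteq> Field R" using \<xi>R by (auto simp: e)
    moreover have "Field R \<union> down_open Q {q} \<subseteq> Field ?A"
      by (auto simp: Field_ord_sum down_open_def FieldI1)
    then have "?e ` Inr ` (Field R \<union> down_open Q {q}) = Field R \<union> down_open Q {q}"
      by (rule eB)
    ultimately show ?thesis by (auto simp: image_Un)
  qed
  moreover have "up_open ?W {Inr q} = Inr ` up_open Q {q}"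
  proof (rule set_eqI)
    fix w show "w \<in> up_open ?W {Inr q} \<longleftrightarrow> w \<in> Inr ` up_open Q {q}"
      by (cases w) (auto simp: up_open_def A)
  qed
  moreover have "?e ` Inr ` up_open Q {q} = up_open Q {q}"
    by (rule eB) (auto simp: Field_ord_sum up_open_def FieldI2)
  ultimately show ?thesis using qA by (simp add: ev_of_def G e Un_commute)
qed

section \<open>Restricting the induced maps to \<open>P\<close>\<close>

lemma I_below_of_ev_hom:
  fixes Pr :: "'p rel set" and Q R S :: "'a rel" and \<epsilon> :: "'a ev \<Rightarrow> 'a ev"
  assumes Pr: "representatives Pr"
    and Q: "fin_poset Q" and R: "fin_poset R" and S: "fin_poset S"
    and disj: "Field Q \<inter> Field R = {}" "Field Q \<inter> Field S = {}"
    and \<epsilon>: "ev_hom (R \<oplus> Q) (S \<oplus> Q) \<epsilon>" and inj: "inj_on \<epsilon> (EV (R \<oplus> Q))"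
    and ind: "\<And>P \<xi> x. P \<in> Pr \<Longrightarrow> \<xi> \<in> hom P (R \<oplus> Q) \<Longrightarrow> x \<in> Field P \<Longrightarrow>
      \<alpha> P (\<eta> \<epsilon> P \<xi>) x = \<epsilon> (\<alpha> P \<xi> x)"
    and cover: "Field Q \<subseteq> (\<lambda>\<aa>. fst (\<epsilon> \<aa>)) ` EV_star (Field R) Q"
  shows "I_below Pr R S"
proof -
  let ?A = "R \<oplus> Q" and ?B = "S \<oplus> Q"
  have QA: "Field Q \<subseteq> Field ?A" by (simp add: Field_ord_sum)
  \<comment> \<open>For the triple of a map at a point of \<open>P\<close>, this is the
    \<open>\<epsilon>\<close>-image of the triple of the extended map.\<close>
  define \<delta> where "\<delta> \<aa> = \<epsilon> (add_up (Field Q) \<aa>)" for \<aa>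
  \<comment> \<open>The \<open>\<epsilon>\<close>-image of the triple at \<open>q\<close>, which all
    extended maps have in common. So \<open>Z\<close> depends neither on the poset nor on the map,
    and triples of different maps can be compared after adding it.\<close>
  define top where "top q = \<epsilon> (q, down_open Q {q} \<union> Field R, up_open Q {q})" for q
  define Z where "Z = (\<lambda>q. fst (top q)) ` Field Q"
  have \<delta>EV: "\<delta> \<aa> \<in> EV ?B" if "\<aa> \<in> EV R" for \<aa>
    using \<epsilon> EV_ord_sum_add_up[OF that disj(1)] by (auto simp: \<delta>_def ev_hom_def)
  have \<delta>star: "(fst (\<delta> \<aa>), fst (\<epsilon> \<bb>)) \<in> ?B" "fst (\<delta> \<aa>) \<noteq> fst (\<epsilon> \<bb>)"
    if "\<aa> \<in> EV R" "\<bb> \<in> EV_star (Field R) Q" for \<aa> \<bb>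
  proof -
    have bA: "\<bb> \<in> EV ?A" using EV_star_subset[OF disj(1)] that(2) by blast
    have "\<delta> \<aa> <\<^sub>+ \<epsilon> \<bb>"
      unfolding \<delta>_def using ev_less_hom[OF \<epsilon> inj EV_ord_sum_add_up[OF that(1) disj(1)] bA]
        add_up_less_EV_star[OF that] by blast
    moreover have "\<epsilon> \<bb> \<in> EV ?B" using \<epsilon> bA by (auto simp: ev_hom_def)
    ultimately show "(fst (\<delta> \<aa>), fst (\<epsilon> \<bb>)) \<in> ?B" "fst (\<delta> \<aa>) \<noteq> fst (\<epsilon> \<bb>)"
      using ev_less_mem by blast+
  qed
  \<comment> \<open>By \<open>\<delta>star\<close> this value differs from the first entry of the
    image of every starred triple, and by \<open>cover\<close> those first entries include all of
    \<open>Q\<close>.\<close>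
  have \<delta>S: "fst (\<delta> \<aa>) \<in> Field S" if "\<aa> \<in> EV R" for \<aa>
  proof (rule ccontr)
    assume "fst (\<delta> \<aa>) \<notin> Field S"
    then have "fst (\<delta> \<aa>) \<in> Field Q" using EV_D(1)[OF \<delta>EV[OF that]] by (simp add: Field_ord_sum)
    then show False using cover \<delta>star(2)[OF that] by fastforce
  qed
  have top_star: "(q, down_open Q {q} \<union> Field R, up_open Q {q}) \<in> EV_star (Field R) Q"
    if "q \<in> Field Q" for q
    using that by (auto simp: EV_star_def EV_def)
  have \<delta>Z: "fst (\<delta> \<aa>) \<notin> Z" if "\<aa> \<in> EV R" for \<aa>
    using \<delta>star(2)[OF that top_star] by (auto simp: Z_def top_def)
  have \<delta>less: "\<delta> \<aa> <\<^sub>+ \<delta> \<bb>" if "\<aa> \<in> EV R" "\<bb> \<in> EV R" "\<aa> <\<^sub>+ \<bb>" for \<aa> \<bb>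
    unfolding \<delta>_def
    using that EV_ord_sum_add_up[OF _ disj(1)]
    by (intro ev_less_hom[OF \<epsilon> inj]) (auto simp: ev_less_def)

  define \<rho> :: "('p, 'a, 'a) scheme" where "\<rho> P \<xi> = (\<lambda>x\<in>Field P. fst (\<delta> (\<alpha> P \<xi> x)))" for P \<xi>
  \<comment> \<open>The triple of the induced map at a point of \<open>P\<close> is computed twice:
    in the glued poset, where \<open>Q\<close> contributes \<open>Z\<close>, and by
    \<open>ind\<close> as an \<open>\<epsilon>\<close>-image.\<close>
  have \<rho>\<alpha>: "add_up Z (\<alpha> P (\<rho> P \<xi>) x) = \<delta> (\<alpha> P \<xi> x)"
    if P: "P \<in> Pr" and \<xi>: "\<xi> \<in> hom P R" and x: "x \<in> Field P" for P \<xi> x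
  proof -
    let ?W = "glue P ?A Q" and ?e = "glue_map P ?A Q \<xi>"
    let ?h = "\<eta> \<epsilon> ?W ?e"
    have fP: "fin_poset P" using P Pr by (simp add: representatives_def)
    have W: "fin_poset ?W"
    proof (rule fin_poset_glue[OF fin_poset_ord_sum[OF R Q disj(1)]])
      show "m \<in> Field Q" if "q \<in> Field Q" "(q, m) \<in> ?A" for q m
        using that disj(1) by (auto simp: ord_sum_iff dest: FieldI1 FieldI2)
    qed (use fP QA in \<open>auto simp: fin_poset_def\<close>)
    have xi: "\<xi> u \<in> Field R" if "u \<in> Field P" for u using \<xi> that by (simp add: hom_iff)
    have FW: "Field ?W = Inl ` Field P \<union> Inr ` Field ?A" by (rule Field_glue[OF QA])
    have eP: "\<alpha> ?W ?e (Inl u) = add_up (Field Q) (\<alpha> P \<xi> u)" if u: "u \<in> Field P" for u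
    proof -
      have "?e (Inr q) = q" if "q \<in> Field Q" for q using glue_map_simps(2)[OF QA] QA that by blast
      moreover from this have "?e (Inr q) \<noteq> \<xi> v" if "v \<in> Field P" "q \<in> Field Q" for v q
        using that xi[of v] disj(1) by auto
      ultimately show ?thesis
        using ev_of_glue_add_up[where h = ?e and k = \<xi>, OF u QA glue_map_simps(1)[OF QA]] by simp
    qed
    have hP: "?h (Inl u) = \<rho> P \<xi> u" if "u \<in> Field P" for u
      using that by (simp add: ev_induced_def FW eP \<rho>_def \<delta>_def)
    have hQ: "?h (Inr q) = fst (top q)" if "q \<in> Field Q" for q
    proof -
      have "Inr q \<in> Field ?W" using that QA by (auto simp: FW)
      then show ?thesis
        using ev_of_glue_map_Inr[OF \<xi> that _ disj(1)] Q by (simp add: ev_induced_def top_def fin_poset_def)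
    qed
    have "?h (Inr q) \<noteq> \<rho> P \<xi> u" if "u \<in> Field P" "q \<in> Field Q" for u q
    proof -
      have "fst (top q) \<in> Z" using that by (simp add: Z_def)
      moreover have "\<rho> P \<xi> u \<notin> Z"
        using \<delta>Z[OF ev_of_mem_EV[OF \<xi> that(1)]] that by (simp add: \<rho>_def)
      ultimately show ?thesis using hQ[OF that(2)] by metis
    qed
    then have "\<alpha> ?W ?h (Inl x) = add_up Z (\<alpha> P (\<rho> P \<xi>) x)"
      using ev_of_glue_add_up[where h = ?h and k = "\<rho> P \<xi>", OF x QA hP] hQ by (simp add: Z_def)
    moreover obtain P' f where "P' \<in> Pr" "ord_iso f ?W P'" using ex_representative[OF Pr W] .
    then have "\<alpha> ?W ?h (Inl x) = \<epsilon> (\<alpha> ?W ?e (Inl x))"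
      using ind x by (intro ev_induced_iso[OF _ glue_map_hom[OF \<xi>]]) (auto simp: FW)
    ultimately show ?thesis by (simp add: eP[OF x] \<delta>_def)
  qed
  have \<rho>x: "\<rho> P \<xi> x = fst (\<delta> (\<alpha> P \<xi> x))" if "x \<in> Field P" for P \<xi> x using that by (simp add: \<rho>_def)
  have \<rho>S: "\<rho> P \<xi> x \<in> Field S" "\<rho> P \<xi> x \<notin> Z" if "\<xi> \<in> hom P R" "x \<in> Field P" for P \<xi> x
    using \<delta>S \<delta>Z ev_of_mem_EV[OF that] by (simp_all add: \<rho>x[OF that(2)])
  have hom: "\<rho> P \<xi> \<in> hom P S" if P: "P \<in> Pr" and \<xi>: "\<xi> \<in> hom P R" for P \<xi>
  proof -
    have "(\<rho> P \<xi> x, \<rho> P \<xi> y) \<in> S" if xy: "(x, y) \<in> P" for x y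
    proof -
      have F: "x \<in> Field P" "y \<in> Field P" using xy by (auto intro: FieldI1 FieldI2)
      note E = ev_of_mem_EV[OF \<xi> F(1)] ev_of_mem_EV[OF \<xi> F(2)]
      consider "\<alpha> P \<xi> x <\<^sub>+ \<alpha> P \<xi> y" | "\<alpha> P \<xi> x = \<alpha> P \<xi> y"
        using ev_of_mono[OF xy] by (auto simp: ev_le_def)
      then show ?thesis
      proof cases
        case 1
        then have "(\<rho> P \<xi> x, \<rho> P \<xi> y) \<in> ?B"
          using ev_less_mem(1)[OF \<delta>EV[OF E(2)] \<delta>less[OF E]] F by (simp add: \<rho>x)
        moreover have "\<rho> P \<xi> x \<in> Field S" "\<rho> P \<xi> y \<in> Field S" using \<rho>S(1) \<xi> F by auto
        ultimately show ?thesis using disj(2) by (auto simp: ord_sum_iff dest: FieldI1)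
      next
        case 2
        then have "\<rho> P \<xi> x = \<rho> P \<xi> y" using F by (simp add: \<rho>x)
        then show ?thesis using fin_posetD(2)[OF S \<rho>S(1)[OF \<xi> F(1)]] by simp
      qed
    qed
    moreover have "\<rho> P \<xi> \<in> extensional (Field P)" by (simp add: \<rho>_def)
    ultimately show ?thesis using \<rho>S(1)[OF \<xi>] by (simp add: hom_iff)
  qed
  \<comment> \<open>The third entry consists of values of \<open>\<rho> P \<xi>\<close>, which avoid
    \<open>Z\<close>; so adding \<open>Z\<close> loses no information.\<close>
  have UZ: "snd (snd (\<alpha> P (\<rho> P \<xi>) x)) \<inter> Z = {}" if "\<xi> \<in> hom P R" for P \<xi> x
    using \<rho>S(2)[OF that] by (auto simp: ev_of_def up_open_def dest!: FieldI2)
  have less: "\<alpha> P (\<rho> P \<xi>) x <\<^sub>+ \<alpha> P' (\<rho> P' \<zeta>) y"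
    if "P \<in> Pr" "P' \<in> Pr" "\<xi> \<in> hom P R" "\<zeta> \<in> hom P' R" "x \<in> Field P" "y \<in> Field P'"
      "\<alpha> P \<xi> x <\<^sub>+ \<alpha> P' \<zeta> y" for P P' \<xi> \<zeta> x y
  proof -
    have "add_up Z (\<alpha> P (\<rho> P \<xi>) x) <\<^sub>+ add_up Z (\<alpha> P' (\<rho> P' \<zeta>) y)"
      using that by (simp add: \<rho>\<alpha> \<delta>less ev_of_mem_EV)
    \<comment> \<open>Only third entries are altered by \<open>add_up\<close>, so this is the one
      value whose membership could be due to \<open>Z\<close>.\<close>
    moreover have "fst (\<alpha> P' (\<rho> P' \<zeta>) y) \<notin> Z" using \<rho>S(2) that by (simp add: ev_of_def)
    ultimately show ?thesis by (simp add: ev_less_def)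
  qed
  have eq: "\<alpha> P (\<rho> P \<xi>) x = \<alpha> P' (\<rho> P' \<zeta>) y"
    if "P \<in> Pr" "P' \<in> Pr" "\<xi> \<in> hom P R" "\<zeta> \<in> hom P' R" "x \<in> Field P" "y \<in> Field P'"
      "\<alpha> P \<xi> x = \<alpha> P' \<zeta> y" for P P' \<xi> \<zeta> x y
  proof -
    have "add_up Z (\<alpha> P (\<rho> P \<xi>) x) = add_up Z (\<alpha> P' (\<rho> P' \<zeta>) y)"
      using \<rho>\<alpha>[OF that(1,3,5)] \<rho>\<alpha>[OF that(2,4,6)] that(7) by simp
    then show ?thesis using UZ[OF that(3)] UZ[OF that(4)] by (rule add_up_inject)
  qed
  have "I_scheme Pr R S \<rho>"
    unfolding I_scheme_def hom_scheme_def
  proof (intro conjI ballI impI)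
    show "\<rho> P \<in> hom P R \<rightarrow> hom P S" if "P \<in> Pr" for P using hom[OF that] by (rule Pi_I)
  next
    fix P P' \<xi> \<zeta> x y
    assume *: "P \<in> Pr" "P' \<in> Pr" "\<xi> \<in> hom P R" "\<zeta> \<in> hom P' R" "x \<in> Field P" "y \<in> Field P'"
    show "\<alpha> P (\<rho> P \<xi>) x <\<^sub>+ \<alpha> P' (\<rho> P' \<zeta>) y" if "\<alpha> P \<xi> x <\<^sub>+ \<alpha> P' \<zeta> y"
      using less[OF * that] .
    show "\<alpha> P (\<rho> P \<xi>) x \<le>\<^sub>+ \<alpha> P' (\<rho> P' \<zeta>) y" if "\<alpha> P \<xi> x \<le>\<^sub>+ \<alpha> P' \<zeta> y"
      using that less[OF *] eq[OF *] unfolding ev_le_def by blast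
  qed
  moreover have "strong_scheme Pr R \<rho>"
    unfolding strong_scheme_def
  proof (intro ballI inj_onI)
    fix P \<xi> \<zeta> assume P: "P \<in> Pr" and h: "\<xi> \<in> hom P R" "\<zeta> \<in> hom P R" "\<rho> P \<xi> = \<rho> P \<zeta>"
    show "\<xi> = \<zeta>"
    proof (rule extensionalityI[of _ "Field P"])
      fix x assume x: "x \<in> Field P"
      \<comment> \<open>By \<open>\<rho>\<alpha>\<close> the image map determines
        \<open>\<delta>\<close> of each triple. As \<open>\<epsilon>\<close> is injective, it
        determines the enlarged triple, whose first entry is the value of the original map.\<close>
      have "\<delta> (\<alpha> P \<xi> x) = \<delta> (\<alpha> P \<zeta> x)" using \<rho>\<alpha>[OF P h(1) x] \<rho>\<alpha>[OF P h(2) x] h(3) by simp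
      then have "add_up (Field Q) (\<alpha> P \<xi> x) = add_up (Field Q) (\<alpha> P \<zeta> x)"
        unfolding \<delta>_def
        by (rule inj_onD[OF inj])
          (use EV_ord_sum_add_up[OF ev_of_mem_EV[OF _ x] disj(1)] h(1,2) in blast)+
      then show "\<xi> x = \<zeta> x" by (simp add: add_up_def ev_of_def)
    qed (use h in \<open>auto simp: hom_iff\<close>)
  qed
  ultimately show ?thesis unfolding I_below_def by blast
qed

theorem theorem7:
  fixes Pr :: "'p rel set" and Q R S :: "'a rel"
  assumes "representatives Pr"
    and "fin_poset Q" and "fin_poset R" and "fin_poset S"
    and "Field Q \<inter> Field R = {}" and "Field Q \<inter> Field S = {}"
  shows "(G_below Pr (R \<oplus> Q) (S \<oplus> Q) \<longrightarrow> G_below Pr R S) \<and>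
    (\<forall>\<epsilon> :: 'a ev \<Rightarrow> 'a ev.
       ev_hom (R \<oplus> Q) (S \<oplus> Q) \<epsilon> \<and> inj_on \<epsilon> (EV (R \<oplus> Q)) \<and>
       (\<forall>P\<in>Pr. \<forall>\<xi>\<in>hom P (R \<oplus> Q). \<forall>x\<in>Field P. \<alpha> P (\<eta> \<epsilon> P \<xi>) x = \<epsilon> (\<alpha> P \<xi> x)) \<and>
       Field Q \<subseteq> (\<lambda>\<aa>. fst (\<epsilon> \<aa>)) ` EV_star (Field R) Q
       \<longrightarrow> I_below Pr R S)"
proof (intro conjI impI allI)
  show "G_below Pr R S" if "G_below Pr (R \<oplus> Q) (S \<oplus> Q)"
    using G_below_cancel[OF assms that] .
next
  fix \<epsilon> :: "'a ev \<Rightarrow> 'a ev"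
  assume "ev_hom (R \<oplus> Q) (S \<oplus> Q) \<epsilon> \<and> inj_on \<epsilon> (EV (R \<oplus> Q)) \<and>
    (\<forall>P\<in>Pr. \<forall>\<xi>\<in>hom P (R \<oplus> Q). \<forall>x\<in>Field P. \<alpha> P (\<eta> \<epsilon> P \<xi>) x = \<epsilon> (\<alpha> P \<xi> x)) \<and>
    Field Q \<subseteq> (\<lambda>\<aa>. fst (\<epsilon> \<aa>)) ` EV_star (Field R) Q"
  then show "I_below Pr R S"
    by (intro I_below_of_ev_hom[OF assms]) blast+
qed

end
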